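(* Let $A,D,E$ be multiplicative characters of $\mathbb{F}_q$ such that $A^2$, $E^2$, $A^2\overline{D^2}\,\overline{E^2}$, $A^2D^2\overline{E^2}$ are all different from $\varepsilon$, $A^2\neq D^2$ and $D^2\neq E^2$. Then for every $z\in\mathbb{F}_q$ with $z\neq1$, \begin{align*} &{}_2F_1(A^2,E^2;\,D^2\mid z)\,{}_2F_1(D^2\overline{E^2},\overline{E^2};\,A^2\overline{E^2}\mid z)\\ &=\frac{E^2(z)}{q}\,\delta(1-z^2)+\frac{AD\overline{E}(4)\,(\overline{A^2}\,\overline{D^2}E^2)(1-z)\,g(A\overline{E}\,\overline{D})\,g(\overline{A}ED\varphi)}{g(\varphi)}\\ &\qquad\times{}_4F_3\!\left(A^2,D^2\overline{E^2},AD\overline{E},AD\overline{E}\varphi;\,A^2D^2\overline{E^2},D^2,A^2\overline{E^2}\;\middle|\;\frac{-4z}{(1-z)^2}\right). \end{align*}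
   Context: Let $p$ be an odd prime, $q=p^r$, and $\mathbb{F}_q$ the field with $q$ elements. Multiplicative characters of $\mathbb{F}_q^\times$ are extended to $\mathbb{F}_q$ by $\chi(0)=0$ (including the trivial character $\varepsilon$). $\varphi$ is the quadratic character. Characters are multiplied pointwise, $\overline{A}$ is the inverse of $A$, and an expression like $(\overline{A^2}\,\overline{D^2}E^2)(1-z)$ means the product character evaluated at $1-z$. For $x\in\mathbb{F}_q$, $\delta(x)=1$ if $x=0$ and $0$ otherwise. The Gauss sum is $g(\chi)=\sum_{x\in\mathbb{F}_q}\chi(x)\theta(x)$ with $\theta(\alpha)=\zeta_p^{\mathrm{tr}(\alpha)}$, $\zeta_p$ a fixed primitive $p$-th root of unity, $\mathrm{tr}$ the trace to $\mathbb{F}_p$. The binomial coefficient is $\binom{A}{B}=\frac{B(-1)}{q}\sum_{x\in\mathbb{F}_q}A(x)\overline{B}(1-x)$. Greene's series: ${}_{n+1}F_n(A_0,\dots,A_n;\,B_1,\dots,B_n\mid x)=\frac{q}{q-1}\sum_{\chi}\binom{A_0\chi}{\chi}\prod_{i=1}^n\binom{A_i\chi}{B_i\chi}\chi(x)$, summed over all multiplicative characters $\chi$. *)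

theory Defs
  imports Complex_Main "HOL-Library.FuncSet" "HOL-Library.Cardinality" "HOL-Computational_Algebra.Primes"
begin

text \<open>
  A multiplicative character of a finite field, extended to the whole field by the value 0 at 0
  (for the trivial character, too).
\<close>

typedef (overloaded) 'a mult_char =
  "{\<chi> :: 'a::{field,finite} \<Rightarrow> complex.
      \<chi> 0 = 0 \<and> \<chi> 1 = 1 \<and> (\<forall>x y. \<chi> (x * y) = \<chi> x * \<chi> y)}"
  morphisms char_at Abs_mult_char
  by (rule exI[of _ "\<lambda>x. if x = 0 then 0 else 1"]) auto

setup_lifting type_definition_mult_char

instantiation mult_char :: ("{field,finite}") comm_monoid_mult
begin

lift_definition one_mult_char :: "'a mult_char" is "\<lambda>x. if x = 0 then 0 else 1"
  by auto

lift_definition times_mult_char :: "'a mult_char \<Rightarrow> 'a mult_char \<Rightarrow> 'a mult_char"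
  is "\<lambda>\<chi> \<psi> x. \<chi> x * \<psi> x"
  by auto

instance
proof
  fix A B C :: "'a mult_char"
  show "A * B * C = A * (B * C)" by transfer (auto simp: mult.assoc)
  show "A * B = B * A" by transfer (auto simp: mult.commute)
  show "1 * A = A" by transfer auto
qed

end

lift_definition char_inv :: "'a::{field,finite} mult_char \<Rightarrow> 'a mult_char"
  is "\<lambda>\<chi> x. inverse (\<chi> x)"
  by auto

lemma char_at_nonzero: "x \<noteq> 0 \<Longrightarrow> char_at A x \<noteq> 0"
proof -
  assume x: "x \<noteq> 0"
  have "char_at A (x * inverse x) = char_at A x * char_at A (inverse x)"
    using char_at[of A] by blast
  moreover have "char_at A (x * inverse x) = 1"
    using char_at[of A] x by simp
  ultimately show ?thesis by auto
qed

lemma char_inv_left: "char_inv A * A = 1"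
proof -
  have "char_at (char_inv A * A) x = char_at 1 x" for x
    using char_at_nonzero[of x A] char_at[of A]
    by (simp add: times_mult_char.rep_eq char_inv.rep_eq one_mult_char.rep_eq)
  then show ?thesis by (simp add: char_at_inject[symmetric] fun_eq_iff)
qed

text \<open>There are finitely many characters, so the sum in the hypergeometric series is a genuine one.\<close>

lemma char_root_of_unity:
  fixes A :: "'a::{field,finite} mult_char"
  assumes "x \<noteq> 0"
  shows "char_at A x ^ card (UNIV - {0::'a}) = 1"
proof -
  let ?U = "UNIV - {0::'a}"
  have mult: "char_at A (u * v) = char_at A u * char_at A v" for u v
    using char_at[of A] by blast
  have "bij_betw ((*) x) ?U ?U"
    by (rule bij_betwI[where g = "\<lambda>y. inverse x * y"]) (use assms in \<open>auto simp: field_simps\<close>)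
  then have "(\<Prod>y\<in>?U. char_at A (x * y)) = (\<Prod>y\<in>?U. char_at A y)"
    by (rule prod.reindex_bij_betw)
  then have "char_at A x ^ card ?U * (\<Prod>y\<in>?U. char_at A y) = (\<Prod>y\<in>?U. char_at A y)"
    by (simp add: mult prod.distrib)
  moreover have "(\<Prod>y\<in>?U. char_at A y) \<noteq> 0"
    using char_at_nonzero[of _ A] by (simp add: prod_zero_iff)
  ultimately show ?thesis by simp
qed

instance mult_char :: ("{field,finite}") finite
proof
  let ?n = "card (UNIV - {0::'a})"
  let ?R = "insert 0 {w :: complex. w ^ ?n = 1}"
  have "card {0, 1 :: 'a} \<le> card (UNIV :: 'a set)"
    by (rule card_mono) auto
  then have "?n > 0" by (simp add: card_Diff_singleton)
  then have "finite ?R" by (simp add: finite_roots_unity Suc_leI)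
  then have "finite (PiE (UNIV :: 'a set) (\<lambda>_. ?R))"
    by (intro finite_PiE) auto
  moreover have "char_at A x \<in> ?R" for A :: "'a mult_char" and x
    using char_root_of_unity[of x A] char_at[of A] by (cases "x = 0") auto
  then have "range (char_at :: 'a mult_char \<Rightarrow> _) \<subseteq> PiE UNIV (\<lambda>_. ?R)"
    by (auto simp: PiE_def extensional_def)
  ultimately have "finite (range (char_at :: 'a mult_char \<Rightarrow> _))"
    by (rule finite_subset[rotated])
  then show "finite (UNIV :: 'a mult_char set)"
    by (rule finite_imageD) (auto simp: inj_on_def char_at_inject)
qed

lemma nonsquare_mult:
  fixes a b :: "'a::{field,finite}"
  assumes a: "\<nexists>y. a = y ^ 2" and b: "\<nexists>y. b = y ^ 2"
  shows "\<exists>y. a * b = y ^ 2"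
proof -
  let ?U = "UNIV - {0::'a}"
  let ?S = "(\<lambda>y. y ^ 2) ` ?U"
  have "a \<noteq> 0" "b \<noteq> 0" using a b by (metis zero_power2)+
  have fib: "card {y \<in> ?U. y ^ 2 = s} \<le> 2" if "s \<in> ?S" for s
  proof -
    obtain y0 where y0: "s = y0 ^ 2" using \<open>s \<in> ?S\<close> by auto
    have "{y \<in> ?U. y ^ 2 = s} \<subseteq> {y0, - y0}"
      using y0 by (auto simp: power2_eq_iff)
    then have "card {y \<in> ?U. y ^ 2 = s} \<le> card {y0, - y0}" by (intro card_mono) auto
    also have "\<dots> \<le> 2" by (simp add: card_insert_if)
    finally show ?thesis .
  qed
  have "card ?U = card (\<Union>s\<in>?S. {y \<in> ?U. y ^ 2 = s})" by (rule arg_cong[of _ _ card]) auto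
  also have "\<dots> \<le> (\<Sum>s\<in>?S. card {y \<in> ?U. y ^ 2 = s})" by (rule card_UN_le) simp
  also have "\<dots> \<le> (\<Sum>s\<in>?S. 2)" by (intro sum_mono fib)
  finally have le: "card ?U \<le> 2 * card ?S" by simp
  have disj: "?S \<inter> (*) a ` ?S = {}"
  proof (rule ccontr)
    assume "?S \<inter> (*) a ` ?S \<noteq> {}"
    then obtain u v where "u \<noteq> 0" "v \<noteq> 0" "u ^ 2 = a * v ^ 2" by auto
    then have "a = (u / v) ^ 2" by (simp add: power_divide)
    with a show False by blast
  qed
  have "card (?S \<union> (*) a ` ?S) = card ?S + card ((*) a ` ?S)"
    using disj by (intro card_Un_disjoint) auto
  also have "card ((*) a ` ?S) = card ?S"
    using \<open>a \<noteq> 0\<close> by (intro card_image) (auto simp: inj_on_def)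
  finally have "card ?U \<le> card (?S \<union> (*) a ` ?S)" using le by simp
  moreover have "?S \<union> (*) a ` ?S \<subseteq> ?U" using \<open>a \<noteq> 0\<close> by auto
  ultimately have "?S \<union> (*) a ` ?S = ?U" by (intro card_seteq) auto
  with \<open>b \<noteq> 0\<close> b obtain s where "b = a * s ^ 2" by blast
  then have "a * b = (a * s) ^ 2" by (simp add: power2_eq_square)
  then show ?thesis by blast
qed

lift_definition quad_char :: "'a::{field,finite} mult_char"
  is "\<lambda>x. if x = 0 then 0 else if \<exists>y. x = y ^ 2 then 1 else -1"
proof -
  have sq: "(\<exists>y. x = y ^ 2) \<Longrightarrow> (\<exists>y. x * z = y ^ 2) \<Longrightarrow> x \<noteq> 0 \<Longrightarrow> \<exists>y. z = y ^ 2" for x z :: 'a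
    by (metis nonzero_mult_div_cancel_left power_divide)
  have "\<exists>y. (1::'a) = y ^ 2" by (rule exI[of _ 1]) simp
  moreover have "(\<exists>y. x * z = y ^ 2) \<longleftrightarrow> ((\<exists>y. x = y ^ 2) \<longleftrightarrow> (\<exists>y. z = y ^ 2))"
    if "x \<noteq> 0" "z \<noteq> 0" for x z :: 'a
    using sq[of x z] sq[of z x] that nonsquare_mult[of x z]
    by (metis mult.commute power_mult_distrib)
  ultimately show ?thesis by auto
qed

definition primitive_root_of_unity :: "nat \<Rightarrow> complex \<Rightarrow> bool" where
  "primitive_root_of_unity n \<zeta> \<longleftrightarrow> \<zeta> ^ n = 1 \<and> (\<forall>k. 0 < k \<and> k < n \<longrightarrow> \<zeta> ^ k \<noteq> 1)"

text \<open>
  In what follows the field has \<open>p ^ r\<close> elements. The trace takes values in the prime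
  field, embedded by \<^const>\<open>of_nat\<close>; \<open>\<zeta>\<close> is raised to the representative
  of the trace in \<open>{0..<p}\<close>.
\<close>

definition field_trace :: "nat \<Rightarrow> nat \<Rightarrow> 'a::{field,finite} \<Rightarrow> 'a" where
  "field_trace p r x = (\<Sum>i<r. x ^ (p ^ i))"

definition add_char :: "complex \<Rightarrow> nat \<Rightarrow> nat \<Rightarrow> 'a::{field,finite} \<Rightarrow> complex" where
  "add_char \<zeta> p r x = \<zeta> ^ (THE n. n < p \<and> of_nat n = field_trace p r x)"

definition gauss_sum :: "complex \<Rightarrow> nat \<Rightarrow> nat \<Rightarrow> 'a::{field,finite} mult_char \<Rightarrow> complex" where
  "gauss_sum \<zeta> p r \<chi> = (\<Sum>x\<in>UNIV. char_at \<chi> x * add_char \<zeta> p r x)"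

definition char_binom :: "'a::{field,finite} mult_char \<Rightarrow> 'a mult_char \<Rightarrow> complex" where
  "char_binom A B =
     char_at B (-1) / of_nat CARD('a) * (\<Sum>x\<in>UNIV. char_at A x * char_at (char_inv B) (1 - x))"

text \<open>
  \<open>greene_F A\<^sub>0 [A\<^sub>1, \<dots>, A\<^sub>n] [B\<^sub>1, \<dots>, B\<^sub>n] x\<close> is the series
  \<open>\<^bsub>n+1\<^esub>F\<^bsub>n\<^esub>(A\<^sub>0, \<dots>, A\<^sub>n; B\<^sub>1, \<dots>, B\<^sub>n | x)\<close>;
  it is only meant for two lists of the same length.
\<close>

definition greene_F ::
  "'a::{field,finite} mult_char \<Rightarrow> 'a mult_char list \<Rightarrow> 'a mult_char list \<Rightarrow> 'a \<Rightarrow> complex" where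
  "greene_F A\<^sub>0 As Bs x =
     of_nat CARD('a) / (of_nat CARD('a) - 1) *
       (\<Sum>\<chi>\<in>UNIV. char_binom (A\<^sub>0 * \<chi>) \<chi> *
          prod_list (map2 (\<lambda>A B. char_binom (A * \<chi>) (B * \<chi>)) As Bs) * char_at \<chi> x)"

definition delta :: "'a::{field,finite} \<Rightarrow> complex" where
  "delta x = (if x = 0 then 1 else 0)"

end

theory Submission
  imports Defs "HOL-Number_Theory.Residues" "HOL-Computational_Algebra.Polynomial"
begin

text \<open>
  Write \<open>a = A\<^sup>2\<close>, \<open>d = D\<^sup>2\<close>, \<open>e = E\<^sup>2\<close>; these take the value 1 at \<open>-1\<close>. By Greene's integral
  representation, \<open>q\<^sup>2\<close> times the left-hand side is
  \<open>\<Sum> e(y/w) (d/e)((1-y)/(1-zw)) a((1-w)/(1-zy))\<close> over all \<open>y, w\<close>. Take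
  \<open>s = (1-w)/(1-zy)\<close> and \<open>t = (1-y)/(1-zw)\<close> as new variables. The lines and the hyperbola on which
  this change of variables degenerates contribute terms that cancel, except for \<open>q\<close> when
  \<open>z = -1\<close>: this is the delta term. Expanding the sum over \<open>s, t\<close> in multiplicative
  characters \<open>\<chi>\<close>, each coefficient is a product of three Jacobi sums. On the other side each
  coefficient is a product of four Jacobi sums, in which the duplication formula for Gauss sums
  merges the two factors containing \<open>AD/E\<close> and \<open>AD\<phi>/E\<close>. Written in Gauss sums, the
  two sides agree for every single \<open>\<chi>\<close>.
\<close>

section \<open>Multiplicative characters\<close>

text \<open>The expansion becomes accessible through a second substitution: rescale \<open>s\<close>
  and \<open>t\<close> by (1-z)/(1-v), where v = stz, to \<open>S\<close> and \<open>T\<close>. Then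
  1-stz-t(1-z) = (1-v)(1-T), and likewise for \<open>s\<close>, so the kernel separates into
  functions of v, \<open>S\<close> and \<open>T\<close>. They are coupled only by z S T (1-v)^2 = v
  (1-z)^2. Detecting this relation by characters produces the argument z/(1-z)^2, and the square of
  1-v puts \<chi>^2 into one Jacobi sum. Its Gauss sum at (AD\<chi>/E)^2 splits by duplication,
  which is the origin of \<phi>, of 1/g(\<phi>), and of the 4 both in -4z and in the prefactor. The
  remaining two Gauss sums of the prefactor cancel those that do not depend on \<chi>.

  The exceptional terms cancel because the two lines and the hyperbola all pass through s = t =
  -1/z, where the kernel is 0/0: on each of them a complete sum of a nontrivial character lacks just
  the value there. The line y+w = 1+1/z, which is mapped to that point, gives the same total, unless
  z = -1: then y/w = -1 on the whole line, the character of y/w is constant, and an extra q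
  appears.\<close>

lemma char_at_0 [simp]: "char_at A 0 = 0"
  and char_at_1 [simp]: "char_at A 1 = 1"
  and char_at_mult_arg: "char_at A (x * y) = char_at A x * char_at A y"
  using char_at[of A] by auto

lemma char_at_eq_0_iff [simp]: "char_at A x = 0 \<longleftrightarrow> x = 0"
  using char_at_nonzero[of x A] by auto

lemma char_at_one: "char_at 1 x = (if x = 0 then 0 else 1)"
  by (simp add: one_mult_char.rep_eq)

lemma char_at_times: "char_at (A * B) x = char_at A x * char_at B x"
  by (simp add: times_mult_char.rep_eq)

lemma char_at_char_inv: "char_at (char_inv A) x = inverse (char_at A x)"
  by (simp add: char_inv.rep_eq)

lemma char_at_inverse_arg: "char_at A (inverse x) = inverse (char_at A x)"
proof (cases "x = 0")
  case False
  then have "char_at A x * char_at A (inverse x) = 1"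
    by (simp flip: char_at_mult_arg)
  then show ?thesis
    by (simp add: inverse_unique)
qed simp

lemma char_at_divide_arg: "char_at A (x / y) = char_at A x / char_at A y"
  by (simp add: field_class.field_divide_inverse char_at_mult_arg char_at_inverse_arg)

lemma char_at_power_arg: "char_at A (x ^ n) = char_at A x ^ n"
  by (induction n) (auto simp: char_at_mult_arg)

lemma char_at_power: "x \<noteq> 0 \<Longrightarrow> char_at (A ^ n) x = char_at A x ^ n"
  by (induction n) (auto simp: char_at_times char_at_one)

lemma char_at_minus_1_cases: "char_at A (-1) = 1 \<or> char_at A (-1) = -1"
proof -
  have "char_at A (-1) * char_at A (-1) = 1"
    by (simp flip: char_at_mult_arg)
  then show ?thesis
    by (simp add: square_eq_1_iff)
qed

lemma char_at_uminus_arg: "char_at A (- x) = char_at A (-1) * char_at A x"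
  using char_at_mult_arg[of A "-1" x] by simp

lemmas char_at_simps = char_at_times char_at_char_inv char_at_mult_arg char_at_divide_arg
  char_at_inverse_arg char_at_power_arg

lemma mult_char_eqI: "(\<And>x. x \<noteq> 0 \<Longrightarrow> char_at A x = char_at B x) \<Longrightarrow> A = B"
  by (metis char_at_0 char_at_inject ext)

lemma char_inv_mult_cancel [simp]:
  "char_inv A * A = 1" "A * char_inv A = 1"
  "char_inv A * (A * B) = B" "A * (char_inv A * B) = B"
  by (simp_all add: char_inv_left mult.commute[of A "char_inv A"] flip: mult.assoc)

lemma char_inv_char_inv [simp]: "char_inv (char_inv A) = A"
  by (rule mult_char_eqI) (simp add: char_at_char_inv)

lemma char_inv_1 [simp]: "char_inv 1 = 1"
  by (rule mult_char_eqI) (simp add: char_at_simps char_at_one)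

lemma char_inv_mult: "char_inv (A * B) = char_inv A * char_inv B"
  by (rule mult_char_eqI) (simp add: char_at_simps)

lemma char_inv_eq_1_iff [simp]: "char_inv A = 1 \<longleftrightarrow> A = 1"
  by (metis char_inv_1 char_inv_char_inv)

lemma mult_char_mult_left_cancel [simp]: "A * B = A * C \<longleftrightarrow> B = (C :: 'a::{field,finite} mult_char)"
  by (metis char_inv_mult_cancel(3))

lemma mult_char_mult_inv_eq_1_iff: "A * char_inv B = 1 \<longleftrightarrow> A = B"
  by (metis char_inv_mult_cancel(1,4) mult.commute mult.right_neutral)

lemma sum_char_at_eq_0:
  fixes A :: "'a::{field,finite} mult_char"
  assumes "A \<noteq> 1"
  shows "(\<Sum>x\<in>UNIV. char_at A x) = 0"
proof -
  obtain u where u: "u \<noteq> 0" "char_at A u \<noteq> 1"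
    using assms mult_char_eqI[of A 1] by (auto simp: char_at_one)
  have "(\<Sum>x\<in>UNIV. char_at A x) = (\<Sum>x\<in>UNIV. char_at A (u * x))"
    by (rule sum.reindex_bij_witness[of _ "\<lambda>x. u * x" "\<lambda>x. x / u"]) (use u in auto)
  also have "\<dots> = char_at A u * (\<Sum>x\<in>UNIV. char_at A x)"
    by (simp add: char_at_mult_arg sum_distrib_left)
  finally show ?thesis
    using u by simp
qed

lemma card_field_gt_1: "CARD('a::{field,finite}) > 1"
  using card_mono[of UNIV "{0, 1 :: 'a}"] by simp

lemma card_units: "card (UNIV - {0 :: 'a::{field,finite}}) = CARD('a) - 1"
  by (simp add: card_Diff_singleton)

lemma sum_char_at_one: "(\<Sum>x\<in>UNIV. char_at (1 :: 'a::{field,finite} mult_char) x) = of_nat CARD('a) - 1"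
proof -
  have "(\<Sum>x\<in>UNIV. char_at (1 :: 'a mult_char) x) = (\<Sum>x\<in>UNIV - {0::'a}. 1)"
    by (rule sum.mono_neutral_cong_right) (auto simp: char_at_one)
  also have "\<dots> = of_nat CARD('a) - 1"
    using card_field_gt_1[where 'a = 'a] by (simp add: card_units of_nat_diff)
  finally show ?thesis .
qed

section \<open>The cyclic unit group and orthogonality over characters\<close>

lemma units_cyclic:
  obtains g :: "'a::{field,finite}" where "g \<noteq> 0" "\<And>x. x \<noteq> 0 \<Longrightarrow> \<exists>i. x = g ^ i"
proof -
  \<comment> \<open>The type-class field is repackaged as a record, so that the theorem on
    generators of finite multiplicative groups applies.\<close>
  define K where "K = (\<lparr>carrier = UNIV :: 'a set, monoid.mult = (*), one = 1, ring.zero = 0, add = (+)\<rparr> :: 'a ring)"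
  have K: "carrier K = UNIV" "\<zero>\<^bsub>K\<^esub> = 0" "x \<otimes>\<^bsub>K\<^esub> y = x * y" "\<one>\<^bsub>K\<^esub> = 1" "x \<oplus>\<^bsub>K\<^esub> y = x + y" for x y
    by (auto simp: K_def)
  have "\<exists>y. x + y = 0" for x :: 'a
    using add.right_inverse by blast
  moreover have "\<exists>y. x * y = 1" if "x \<noteq> 0" for x :: 'a
    using that right_inverse by blast
  ultimately interpret K: field K
    by unfold_locales (auto simp: K algebra_simps Units_def)
  have pow: "x [^]\<^bsub>K\<^esub> (i::nat) = x ^ i" for x i
    by (induction i) (simp_all add: K mult.commute)
  obtain g where "g \<in> carrier (mult_of K)"
    "carrier (mult_of K) = {g [^]\<^bsub>K\<^esub> i | i::nat. i \<in> UNIV}"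
    using K.finite_field_mult_group_has_gen K by auto
  then have "g \<noteq> 0" "UNIV - {0} = {g ^ i | i. True}"
    by (auto simp: carrier_mult_of K pow)
  then show ?thesis
    using that[of g] by blast
qed

lemma units_power_card:
  fixes x :: "'a::{field,finite}"
  assumes "x \<noteq> 0"
  shows "x ^ (CARD('a) - 1) = 1"
proof -
  have "(\<Prod>y\<in>UNIV-{0}. y) = (\<Prod>y\<in>UNIV-{0}. x * y)"
    by (rule prod.reindex_bij_witness[of _ "\<lambda>y. x * y" "\<lambda>y. y / x"]) (use assms in auto)
  also have "\<dots> = x ^ (CARD('a) - 1) * (\<Prod>y\<in>UNIV-{0}. y)"
    by (simp add: prod.distrib card_units)
  finally show ?thesis
    by (simp add: prod_zero_iff)
qed

text \<open>A discrete logarithm to a generator, followed by powers of a primitive root of unity of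
  order \<open>CARD('a) - 1\<close>, is an injective character on the units. It therefore separates
  every \<open>x\<close> from 1.\<close>

lemma exists_char_at_neq_1:
  fixes x :: "'a::{field,finite}"
  assumes "x \<noteq> 0" "x \<noteq> 1"
  shows "\<exists>\<chi>. char_at \<chi> x \<noteq> 1"
proof -
  obtain g :: 'a where g: "g \<noteq> 0" "\<And>x. x \<noteq> 0 \<Longrightarrow> \<exists>i. x = g ^ i"
    using units_cyclic by blast
  define n where "n = CARD('a) - 1"
  have n: "n > 0"
    using card_field_gt_1[where 'a = 'a] by (simp add: n_def)
  have g1: "g ^ n = 1"
    using units_power_card[OF g(1)] by (simp add: n_def)
  have modn: "g ^ i = g ^ (i mod n)" for i
  proof -
    have "g ^ i = g ^ (i mod n + n * (i div n))" by simp
    also have "\<dots> = g ^ (i mod n)"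
      by (simp only: power_add power_mult g1) simp
    finally show ?thesis .
  qed
  \<comment> \<open>The \<open>n\<close> powers with exponent below \<open>n\<close> exhaust the
    \<open>n\<close> nonzero elements, so they are distinct, and equal powers have exponents
    congruent modulo \<open>n\<close>.\<close>
  have "UNIV - {0} \<subseteq> (\<lambda>i. g ^ i) ` {..<n}"
  proof
    fix x :: 'a
    assume "x \<in> UNIV - {0}"
    then obtain i where "x = g ^ i"
      using g(2) by blast
    then have "x = g ^ (i mod n)" "i mod n \<in> {..<n}"
      using modn[of i] n by auto
    then show "x \<in> (\<lambda>i. g ^ i) ` {..<n}"
      by (rule image_eqI)
  qed
  moreover have "(\<lambda>i. g ^ i) ` {..<n} \<subseteq> UNIV - {0}"
    using g(1) by auto
  ultimately have img: "(\<lambda>i. g ^ i) ` {..<n} = UNIV - {0}"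
    by blast
  then have inj: "inj_on (\<lambda>i. g ^ i) {..<n}"
    by (intro eq_card_imp_inj_on) (simp_all add: n_def card_units)
  have geq: "i mod n = j mod n" if "g ^ i = g ^ j" for i j
    using inj modn[of i] modn[of j] that n by (simp add: inj_on_def)
  define \<omega> where "\<omega> = cis (2 * pi / real n)"
  have \<omega>n: "\<omega> ^ n = 1"
    using n by (simp add: \<omega>_def DeMoivre)
  have \<omega>mod: "\<omega> ^ i = \<omega> ^ (i mod n)" for i
  proof -
    have "\<omega> ^ i = \<omega> ^ (i mod n + n * (i div n))" by simp
    also have "\<dots> = \<omega> ^ (i mod n)"
      by (simp only: power_add power_mult \<omega>n) simp
    finally show ?thesis .
  qed
  have \<omega>1: "\<omega> ^ i \<noteq> 1" if "0 < i" "i < n" for i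
  proof
    assume "\<omega> ^ i = 1"
    then have "cis (2 * pi * real i / real n) = 1"
      by (simp add: \<omega>_def DeMoivre mult_ac)
    then have "cos (2 * pi * real i / real n) = 1"
      by (metis Re_complex_of_real cis.simps(1) of_real_1)
    then obtain k :: int where "2 * pi * real i / real n = of_int k * 2 * pi"
      by (auto simp: cos_one_2pi_int)
    then have "real i = of_int k * real n"
      using n by (simp add: field_simps)
    then have "int i = k * int n"
      by (metis of_int_eq_iff of_int_mult of_int_of_nat_eq)
    then have "int n dvd int i"
      by simp
    then have "n dvd i"
      by (simp only: int_dvd_int_iff)
    with that show False
      using nat_dvd_not_less by blast
  qed
  \<comment> \<open>The exponent is an arbitrary choice; only its residue modulo \<open>n\<close> is
    determined, and \<open>\<omega> ^ lg y\<close> depends on nothing else.\<close>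
  define lg where "lg y = (SOME i. y = g ^ i)" for y
  have lg: "g ^ lg y = y" if "y \<noteq> 0" for y
    unfolding lg_def using someI_ex[OF g(2)[OF that]] by (rule sym)
  define f where "f y = (if y = 0 then 0 else \<omega> ^ lg y)" for y
  have f: "f 0 = 0 \<and> f 1 = 1 \<and> (\<forall>x y. f (x * y) = f x * f y)"
  proof (intro conjI allI)
    have "lg 1 mod n = 0 mod n"
      using lg[of 1] by (intro geq) simp
    then show "f 1 = 1"
      using \<omega>mod[of "lg 1"] by (simp add: f_def)
    show "f (x * y) = f x * f y" for x y
    proof (cases "x = 0 \<or> y = 0")
      case False
      then have "g ^ lg (x * y) = g ^ (lg x + lg y)"
        using lg[of "x * y"] lg[of x] lg[of y] by (simp add: power_add)
      then have "\<omega> ^ lg (x * y) = \<omega> ^ (lg x + lg y)"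
        using geq \<omega>mod by metis
      then show ?thesis
        using False by (simp add: f_def power_add)
    qed (auto simp: f_def)
  qed (simp add: f_def)
  then have "char_at (Abs_mult_char f) = f"
    by (simp add: Abs_mult_char_inverse)
  moreover have "f x \<noteq> 1"
  proof -
    have "lg x mod n \<noteq> 0"
      using lg[OF assms(1)] modn[of "lg x"] assms(2) by (metis power_0)
    then show ?thesis
      using \<omega>1[of "lg x mod n"] n \<omega>mod[of "lg x"] assms(1) by (simp add: f_def)
  qed
  ultimately show ?thesis
    by metis
qed

text \<open>The value at 1 is the number of characters. It is found by summing over all pairs of a
  character and a field element in both orders: one order leaves only the element 1, the other only
  the trivial character.\<close>

lemma sum_mult_char:
  fixes x :: "'a::{field,finite}"
  shows "(\<Sum>\<chi>\<in>UNIV. char_at \<chi> x) = (if x = 1 then of_nat CARD('a) - 1 else 0)"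
proof -
  have 0: "(\<Sum>\<chi>\<in>UNIV. char_at \<chi> y) = (0::complex)" if "y \<noteq> 1" for y :: 'a
  proof (cases "y = 0")
    case False
    note \<open>y \<noteq> 1\<close>
    with False obtain \<psi> :: "'a mult_char" where \<psi>: "char_at \<psi> y \<noteq> 1"
      using exists_char_at_neq_1[of y] by auto
    have "(\<Sum>\<chi>\<in>UNIV. char_at \<chi> y) = (\<Sum>\<chi>\<in>UNIV. char_at (\<psi> * \<chi>) y)"
      by (rule sum.reindex_bij_witness[of _ "\<lambda>\<chi>. \<psi> * \<chi>" "\<lambda>\<chi>. char_inv \<psi> * \<chi>"]) auto
    also have "\<dots> = char_at \<psi> y * (\<Sum>\<chi>\<in>UNIV. char_at \<chi> y)"
      by (simp add: char_at_times sum_distrib_left)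
    finally show ?thesis
      using \<psi> by simp
  qed simp
  have "(\<Sum>\<chi>\<in>UNIV. char_at \<chi> (1::'a)) = (\<Sum>y\<in>UNIV. \<Sum>\<chi>\<in>UNIV. char_at \<chi> (y::'a))"
    using sum.mono_neutral_right[of UNIV "{1::'a}" "\<lambda>y. \<Sum>\<chi>\<in>UNIV. char_at \<chi> y"] 0 by simp
  also have "\<dots> = (\<Sum>\<chi>\<in>UNIV. \<Sum>y\<in>UNIV. char_at \<chi> (y::'a))"
    by (rule sum.swap)
  also have "\<dots> = (\<Sum>\<chi>\<in>{1 :: 'a mult_char}. \<Sum>y\<in>UNIV. char_at \<chi> (y::'a))"
    by (rule sum.mono_neutral_right) (auto simp: sum_char_at_eq_0)
  also have "\<dots> = of_nat CARD('a) - 1"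
    by (simp add: sum_char_at_one)
  finally show ?thesis
    using 0 by simp
qed

section \<open>Jacobi and Gauss sums\<close>

definition jacobi_sum :: "'a::{field,finite} mult_char \<Rightarrow> 'a mult_char \<Rightarrow> complex" where
  "jacobi_sum A B = (\<Sum>x\<in>UNIV. char_at A x * char_at B (1 - x))"

lemma char_binom_eq_jacobi_sum:
  "char_binom A B = char_at B (-1) / of_nat CARD('a) * jacobi_sum A (char_inv B)"
  for A B :: "'a::{field,finite} mult_char"
  by (simp add: char_binom_def jacobi_sum_def)

lemma jacobi_sum_commute: "jacobi_sum A B = jacobi_sum B A"
  unfolding jacobi_sum_def
  by (rule sum.reindex_bij_witness[of _ "\<lambda>x. 1 - x" "\<lambda>x. 1 - x"]) (auto simp: mult.commute)

text \<open>The involution \<open>x / (x - 1)\<close> of the field without 1 sends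
  \<open>1 - x\<close> to \<open>-1 / (x - 1)\<close>. The two factors B(-1) that arise cancel, and
  A(-1) remains.\<close>

lemma jacobi_sum_reflect: "jacobi_sum A B = char_at A (-1) * jacobi_sum A (char_inv (A * B))"
proof -
  have "jacobi_sum A B = (\<Sum>x\<in>UNIV-{1}. char_at A x * char_at B (1 - x))"
    unfolding jacobi_sum_def by (rule sum.mono_neutral_right) auto
  also have "\<dots> = (\<Sum>y\<in>UNIV-{1}. char_at A (-1) * (char_at A y * char_at (char_inv (A * B)) (1 - y)))"
  proof (rule sum.reindex_bij_witness[of _ "\<lambda>y. y / (y - 1)" "\<lambda>y. y / (y - 1)"])
    fix x :: 'a
    assume "x \<in> UNIV - {1}"
    then have x: "x - 1 \<noteq> 0" by simp
    have 1: "1 - x / (x - 1) = (-1) / (x - 1)"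
      using x by (simp add: field_simps)
    then show "x / (x - 1) / (x / (x - 1) - 1) = x" "x / (x - 1) / (x / (x - 1) - 1) = x"
      using x by (simp_all add: field_simps)
    show "x / (x - 1) \<in> UNIV - {1}"  "x / (x - 1) \<in> UNIV - {1}"
      using x by (simp_all add: field_simps)
    have 3: "char_at C (x - 1) = char_at C (-1) * char_at C (1 - x)" for C
      using char_at_uminus_arg[of C "1 - x"] by simp
    have m1: "char_at A (-1) * char_at A (-1) = 1" "char_at B (-1) * char_at B (-1) = 1"
      by (simp_all flip: char_at_mult_arg)
    have n1: "char_at A (1 - x) \<noteq> 0" "char_at B (1 - x) \<noteq> 0"
      "char_at A (-1) \<noteq> 0" "char_at B (-1) \<noteq> 0"
      using x by auto
    show "char_at A (-1) * (char_at A (x / (x - 1)) * char_at (char_inv (A * B)) (1 - x / (x - 1)))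
       = char_at A x * char_at B (1 - x)"
      unfolding 1 char_at_simps 3 using m1 n1 by (simp add: field_simps)
  qed
  also have "\<dots> = (\<Sum>y\<in>UNIV. char_at A (-1) * (char_at A y * char_at (char_inv (A * B)) (1 - y)))"
    by (rule sum.mono_neutral_left) auto
  finally show ?thesis
    by (simp add: jacobi_sum_def sum_distrib_left)
qed

text \<open>Since the trivial character is 0 at 0, the complete sum of \<open>A\<close> loses its
  term at 1.\<close>

lemma jacobi_sum_one: "A \<noteq> 1 \<Longrightarrow> jacobi_sum A 1 = -1"
proof -
  assume A: "A \<noteq> 1"
  have "jacobi_sum A 1 = (\<Sum>x\<in>UNIV-{1}. char_at A x)"
    unfolding jacobi_sum_def by (rule sum.mono_neutral_cong_right) (auto simp: char_at_one)
  also have "\<dots> = (\<Sum>x\<in>UNIV. char_at A x) - 1"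
    by (subst sum.remove[of UNIV 1]) auto
  finally show ?thesis
    using sum_char_at_eq_0[OF A] by simp
qed

section \<open>The quadratic character\<close>

lemma char_at_quad_char:
  "char_at quad_char x = (if x = 0 then 0 else if \<exists>y. x = y ^ 2 then 1 else -1)"
  by (simp add: quad_char.rep_eq)

lemma card_square_roots:
  fixes s :: "'a::{field,finite}"
  assumes "(2 :: 'a) \<noteq> 0"
  shows "of_nat (card {t. t ^ 2 = s}) = 1 + char_at quad_char s"
proof (cases "\<exists>y. s = y ^ 2")
  case True
  then obtain y where y: "s = y ^ 2" by blast
  then have eq: "{t. t ^ 2 = s} = {y, - y}"
    by (auto simp: power2_eq_iff)
  show ?thesis
  proof (cases "y = 0")
    case False
    have "y \<noteq> - y"
    proof
      assume "y = - y"
      then have "2 * y = 0" by (metis add.right_inverse mult_2)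
      with False assms show False by simp
    qed
    then have "card {t. t ^ 2 = s} = 2"
      by (simp add: eq)
    moreover have "char_at quad_char s = 1"
      using False y by (auto simp: char_at_quad_char)
    ultimately show ?thesis
      by simp
  qed (use y eq in simp)
next
  case False
  then have "{t. t ^ 2 = s} = {}" by auto
  moreover have "s \<noteq> 0"
    using False by (metis zero_power2)
  ultimately show ?thesis
    using False by (simp add: char_at_quad_char)
qed

lemma sum_squares:
  fixes f :: "'a::{field,finite} \<Rightarrow> complex"
  assumes "(2 :: 'a) \<noteq> 0"
  shows "(\<Sum>t\<in>UNIV. f (t ^ 2)) = (\<Sum>s\<in>UNIV. (1 + char_at quad_char s) * f s)"
proof -
  have "(\<Sum>t\<in>UNIV. f (t ^ 2)) = (\<Sum>s\<in>UNIV. \<Sum>t\<in>{t\<in>UNIV. t ^ 2 = s}. f (t ^ 2))"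
    by (rule sum.group[symmetric]) auto
  also have "\<dots> = (\<Sum>s\<in>UNIV. \<Sum>t\<in>{t. t ^ 2 = s}. f s)"
    by (intro sum.cong) auto
  also have "\<dots> = (\<Sum>s\<in>UNIV. (1 + char_at quad_char s) * f s)"
    by (simp add: card_square_roots[OF assms])
  finally show ?thesis .
qed

lemma quad_char_mult_self: "quad_char * quad_char = 1"
  by (rule mult_char_eqI) (simp add: char_at_times char_at_quad_char char_at_one)

text \<open>Such an \<open>X\<close> is 1 on nonzero squares. If it differs from 1 at a nonsquare
  \<open>n\<close>, then it is -1 at every nonsquare \<open>x\<close>, because \<open>n * x\<close>
  is a square.\<close>

lemma mult_char_square_eq_1:
  assumes "X * X = 1"
  shows "X = 1 \<or> X = quad_char"
proof (cases "X = 1")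
  case False
  have pm: "char_at X x = 1 \<or> char_at X x = -1" if "x \<noteq> 0" for x
    using arg_cong[OF assms, of "\<lambda>C. char_at C x"] that
    by (simp add: char_at_times char_at_one square_eq_1_iff)
  have sq: "char_at X (y ^ 2) = 1" if "y \<noteq> 0" for y
    using pm[OF that] by (auto simp: char_at_power_arg)
  obtain n where n: "n \<noteq> 0" "char_at X n \<noteq> 1"
    using False mult_char_eqI[of X 1] by (auto simp: char_at_one)
  then have nsq: "\<nexists>y. n = y ^ 2"
    using sq by (metis zero_power2)
  have "X = quad_char"
  proof (rule mult_char_eqI)
    fix x :: 'a
    assume x: "x \<noteq> 0"
    show "char_at X x = char_at quad_char x"
    proof (cases "\<exists>y. x = y ^ 2")
      case True
      then show ?thesis
        using x sq by (auto simp: char_at_quad_char)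
    next
      case False
      then obtain y where y: "n * x = y ^ 2"
        using nonsquare_mult[OF nsq] by blast
      then have "y \<noteq> 0" using n x by auto
      then have "char_at X n * char_at X x = 1"
        using sq y by (metis char_at_mult_arg)
      then show ?thesis
        using False x n pm[OF n(1)] pm[OF x] by (auto simp: char_at_quad_char)
    qed
  qed
  then show ?thesis ..
qed simp

lemma jacobi_sum_self:
  fixes X :: "'a::{field,finite} mult_char"
  assumes 2: "(2 :: 'a) \<noteq> 0" and X: "X \<noteq> 1"
  shows "char_at X 4 * jacobi_sum X X = jacobi_sum X quad_char"
proof -
  \<comment> \<open>Completing the square: 4x(1-x) = 1-(1-2x)^2.\<close>
  have "char_at X 4 * jacobi_sum X X = (\<Sum>x\<in>UNIV. char_at X (1 - (1 - 2 * x) ^ 2))"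
    unfolding jacobi_sum_def sum_distrib_left
    by (intro sum.cong refl) (auto simp flip: char_at_mult_arg simp: algebra_simps power2_eq_square)
  also have "\<dots> = (\<Sum>t\<in>UNIV. char_at X (1 - t ^ 2))"
    by (rule sum.reindex_bij_witness[of _ "\<lambda>t. (1 - t) / 2" "\<lambda>x. 1 - 2 * x"])
       (use 2 in \<open>auto simp: field_simps\<close>)
  also have "\<dots> = (\<Sum>s\<in>UNIV. (1 + char_at quad_char s) * char_at X (1 - s))"
    by (rule sum_squares[OF 2])
  also have "\<dots> = (\<Sum>s\<in>UNIV. char_at X (1 - s)) + jacobi_sum quad_char X"
    by (simp add: jacobi_sum_def algebra_simps sum.distrib)
  also have "(\<Sum>s\<in>UNIV. char_at X (1 - s)) = (\<Sum>s\<in>UNIV. char_at X s)"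
    by (rule sum.reindex_bij_witness[of _ "\<lambda>x. 1 - x" "\<lambda>x. 1 - x"]) auto
  finally show ?thesis
    using sum_char_at_eq_0[OF X] by (simp add: jacobi_sum_commute)
qed

text \<open>The theory of Gauss sums is developed for an abstract nontrivial additive character; the
  trace enters only when the locale is instantiated.\<close>

locale additive_character =
  fixes \<theta> :: "'a::{field,finite} \<Rightarrow> complex"
  assumes add: "\<theta> (x + y) = \<theta> x * \<theta> y"
    and nontrivial: "\<exists>x. \<theta> x \<noteq> 1"
    and zero: "\<theta> 0 = 1"
begin

definition gauss :: "'a mult_char \<Rightarrow> complex" where
  "gauss \<chi> = (\<Sum>x\<in>UNIV. char_at \<chi> x * \<theta> x)"

lemma sum_eq_0: "(\<Sum>x\<in>UNIV. \<theta> x) = 0"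
proof -
  obtain u where u: "\<theta> u \<noteq> 1"
    using nontrivial by blast
  have "(\<Sum>x\<in>UNIV. \<theta> x) = (\<Sum>x\<in>UNIV. \<theta> (u + x))"
    by (rule sum.reindex_bij_witness[of _ "\<lambda>x. u + x" "\<lambda>x. x - u"]) auto
  also have "\<dots> = \<theta> u * (\<Sum>x\<in>UNIV. \<theta> x)"
    by (simp add: add sum_distrib_left)
  finally show ?thesis
    using u by simp
qed

lemma gauss_one: "gauss 1 = -1"
proof -
  have "gauss 1 = (\<Sum>x\<in>UNIV-{0}. \<theta> x)"
    unfolding gauss_def by (rule sum.mono_neutral_cong_right) (auto simp: char_at_one)
  also have "\<dots> = (\<Sum>x\<in>UNIV. \<theta> x) - \<theta> 0"
    by (subst sum.remove[of UNIV 0]) auto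
  finally show ?thesis
    by (simp add: sum_eq_0 zero)
qed

text \<open>Collect the pairs by \<open>u = x + y\<close>. For nonzero \<open>u\<close>, scaling by
  \<open>u\<close> gives a Jacobi sum; \<open>u = 0\<close> gives the second summand, which survives
  only for \<open>A * B = 1\<close>.\<close>

lemma gauss_mult:
  "gauss A * gauss B =
     jacobi_sum A B * gauss (A * B) + char_at B (-1) * (\<Sum>x\<in>UNIV. char_at (A * B) x)"
proof -
  have "gauss A * gauss B = (\<Sum>x\<in>UNIV. \<Sum>y\<in>UNIV. char_at A x * char_at B y * \<theta> (x + y))"
    by (simp add: gauss_def sum_product add mult_ac)
  also have "\<dots> = (\<Sum>x\<in>UNIV. \<Sum>u\<in>UNIV. char_at A x * char_at B (u - x) * \<theta> u)"
  proof (rule sum.cong)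
    fix x :: 'a
    show "(\<Sum>y\<in>UNIV. char_at A x * char_at B y * \<theta> (x + y)) =
        (\<Sum>u\<in>UNIV. char_at A x * char_at B (u - x) * \<theta> u)"
      by (rule sum.reindex_bij_witness[of _ "\<lambda>u. u - x" "\<lambda>y. x + y"]) auto
  qed simp
  also have "\<dots> = (\<Sum>u\<in>UNIV. \<Sum>x\<in>UNIV. char_at A x * char_at B (u - x) * \<theta> u)"
    by (rule sum.swap)
  also have "\<dots> = (\<Sum>u\<in>UNIV - {0}. \<Sum>x\<in>UNIV. char_at A x * char_at B (u - x) * \<theta> u)
      + (\<Sum>x\<in>UNIV. char_at A x * char_at B (- x))"
    by (subst sum.remove[of UNIV 0]) (auto simp: zero)
  also have "(\<Sum>x\<in>UNIV. char_at A x * char_at B (- x)) =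
      char_at B (-1) * (\<Sum>x\<in>UNIV. char_at (A * B) x)"
    unfolding sum_distrib_left
  proof (rule sum.cong)
    fix x :: 'a
    show "char_at A x * char_at B (- x) = char_at B (-1) * char_at (A * B) x"
      using char_at_uminus_arg[of B x] by (simp add: char_at_times)
  qed simp
  also have "(\<Sum>u\<in>UNIV - {0}. \<Sum>x\<in>UNIV. char_at A x * char_at B (u - x) * \<theta> u) =
      (\<Sum>u\<in>UNIV - {0}. jacobi_sum A B * (char_at (A * B) u * \<theta> u))"
  proof (rule sum.cong)
    fix u :: 'a
    assume "u \<in> UNIV - {0}"
    then have u: "u \<noteq> 0" by simp
    have "(\<Sum>x\<in>UNIV. char_at A x * char_at B (u - x) * \<theta> u) =
        (\<Sum>x\<in>UNIV. char_at A (u * x) * char_at B (u - u * x) * \<theta> u)"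
      by (rule sum.reindex_bij_witness[of _ "\<lambda>x. u * x" "\<lambda>x. x / u"]) (use u in auto)
    also have "\<dots> = (\<Sum>x\<in>UNIV. char_at A x * char_at B (1 - x) * (char_at (A * B) u * \<theta> u))"
    proof (rule sum.cong)
      fix x
      have "u - u * x = u * (1 - x)" by (simp add: algebra_simps)
      then show "char_at A (u * x) * char_at B (u - u * x) * \<theta> u =
          char_at A x * char_at B (1 - x) * (char_at (A * B) u * \<theta> u)"
        by (simp add: char_at_times char_at_mult_arg mult_ac)
    qed simp
    also have "\<dots> = jacobi_sum A B * (char_at (A * B) u * \<theta> u)"
      by (simp only: jacobi_sum_def sum_distrib_right)
    finally show "(\<Sum>x\<in>UNIV. char_at A x * char_at B (u - x) * \<theta> u) =
      jacobi_sum A B * (char_at (A * B) u * \<theta> u)" .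
  qed simp
  also have "\<dots> = jacobi_sum A B * gauss (A * B)"
    unfolding gauss_def sum_distrib_left by (rule sum.mono_neutral_left) auto
  finally show ?thesis .
qed

lemma gauss_mult_inv:
  assumes "A \<noteq> 1"
  shows "gauss A * gauss (char_inv A) = char_at A (-1) * of_nat CARD('a)"
proof -
  have "jacobi_sum A (char_inv A) = - char_at A (-1)"
    using jacobi_sum_reflect[of A "char_inv A"] jacobi_sum_one[OF assms] by simp
  moreover have "inverse (char_at A (-1)) = char_at A (-1)"
    using char_at_minus_1_cases[of A] by auto
  ultimately show ?thesis
    by (simp add: gauss_mult gauss_one sum_char_at_one char_at_char_inv algebra_simps)
qed

lemma gauss_nonzero [simp]: "gauss A \<noteq> 0"
proof (cases "A = 1")
  case False
  then show ?thesis
    using gauss_mult_inv[OF False] by auto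
qed (simp add: gauss_one)

lemma jacobi_sum_eq_gauss:
  assumes "A * B \<noteq> 1"
  shows "jacobi_sum A B = gauss A * gauss B / gauss (A * B)"
  by (simp add: gauss_mult sum_char_at_eq_0[OF assms])

text \<open>The Hasse-Davenport product formula for the quadratic character. If X^2 is nontrivial,
  it is \<open>jacobi_sum_self\<close> written in Gauss sums; otherwise \<open>X\<close> is trivial
  or quadratic, and X(4) = X^2(2) = 1.\<close>

lemma gauss_duplication:
  assumes 2: "(2 :: 'a) \<noteq> 0"
  shows "char_at X 4 * (gauss X * gauss (X * quad_char)) = gauss (X * X) * gauss quad_char"
proof (cases "X * X = 1")
  case True
  have "char_at X 4 = char_at (X * X) 2"
    by (simp add: char_at_times flip: char_at_mult_arg)
  then have "char_at X 4 = 1"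
    using 2 by (simp add: True char_at_one)
  then show ?thesis
    using mult_char_square_eq_1[OF True] by (auto simp: quad_char_mult_self)
next
  case False
  then have X: "X \<noteq> 1" by auto
  have "X * quad_char \<noteq> 1"
    using False quad_char_mult_self mult_char_mult_left_cancel
    by (metis mult.assoc mult.left_neutral mult.right_neutral)
  then have J: "jacobi_sum X quad_char * gauss (X * quad_char) = gauss X * gauss quad_char"
    by (simp add: jacobi_sum_eq_gauss)
  have "gauss X * gauss X = jacobi_sum X X * gauss (X * X)"
    by (simp add: jacobi_sum_eq_gauss False)
  \<comment> \<open>The extra nonzero factor \<open>gauss X\<close> makes both Jacobi sums appear;
    it is cancelled at the end.\<close>
  then have "gauss X * (char_at X 4 * (gauss X * gauss (X * quad_char))) =
      (char_at X 4 * jacobi_sum X X) * gauss (X * quad_char) * gauss (X * X)"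
    by (simp add: algebra_simps)
  also have "\<dots> = gauss X * (gauss (X * X) * gauss quad_char)"
    by (simp add: jacobi_sum_self[OF 2 X] J)
  finally have "gauss X * (char_at X 4 * (gauss X * gauss (X * quad_char))) =
      gauss X * (gauss (X * X) * gauss quad_char)" .
  then show ?thesis
    by simp
qed

end

section \<open>The additive character from the trace\<close>

lemma prime_char_from_card:
  assumes "prime p" "CARD('a::{field,finite}) = p ^ r"
  shows "CHAR('a) = p"
proof -
  have "prime CHAR('a)"
    by (simp add: finite_imp_CHAR_pos prime_CHAR_semidom)
  moreover have "CHAR('a) dvd p ^ r"
    using CHAR_dvd_CARD[where 'a = 'a] assms by simp
  ultimately show ?thesis
    using assms(1) prime_dvd_power primes_dvd_imp_eq by blast
qed

context
  fixes p r :: nat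
  assumes p: "prime p" and card: "CARD('a::{field,finite}) = p ^ r"
begin

private abbreviation tr :: "'a \<Rightarrow> 'a" where
  "tr \<equiv> field_trace p r"

lemma r_pos: "r > 0"
  using card_field_gt_1[where 'a = 'a] card by (cases r) auto

lemma field_trace_add: "tr (x + y) = tr x + tr y"
  using freshmans_dream'[of _ _ x y] p prime_char_from_card[OF p card]
  by (simp add: field_trace_def sum.distrib)

text \<open>Frobenius shifts the summands of the trace cyclically, because
  \<open>x ^ (p ^ r) = x\<close>.\<close>

lemma field_trace_power: "tr x ^ p = tr x"
proof -
  have frob: "(\<Sum>i\<in>I. f i) ^ p = (\<Sum>i\<in>I. f i ^ p)" for I :: "nat set" and f :: "nat \<Rightarrow> 'a"
    using freshmans_dream[where 'a = 'a, OF _ refl] p prime_char_from_card[OF p card]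
    by (induction I rule: infinite_finite_induct) (simp_all add: prime_gt_0_nat)
  obtain m where m: "r = Suc m"
    using r_pos by (cases r) auto
  have "x ^ CARD('a) = x ^ (CARD('a) - 1) * x"
    using card_field_gt_1[where 'a = 'a] by (subst power_minus_mult) auto
  also have "\<dots> = x"
    using units_power_card[of x] by (cases "x = 0") auto
  finally have last: "x ^ (p ^ Suc m) = x ^ (p ^ 0)"
    by (simp add: card m)
  have "tr x ^ p = (\<Sum>i<r. x ^ (p ^ Suc i))"
    by (simp add: field_trace_def frob mult.commute flip: power_mult)
  also have "\<dots> = (\<Sum>i<m. x ^ (p ^ Suc i)) + x ^ (p ^ 0)"
    unfolding m sum.lessThan_Suc last ..
  also have "\<dots> = tr x"
    unfolding field_trace_def m sum.lessThan_Suc_shift by simp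
  finally show ?thesis .
qed

lemma of_nat_inj_below_char: "i < p \<Longrightarrow> j < p \<Longrightarrow> of_nat i = (of_nat j :: 'a) \<Longrightarrow> i = j"
  using of_nat_eq_iff_cong_CHAR[where 'a = 'a, of i j] prime_char_from_card[OF p card]
  by (simp add: cong_def)

text \<open>The polynomial X^p - X has at most \<open>p\<close> roots, and the images of 0, ..., p-1
  are already \<open>p\<close> of them.\<close>

lemma prime_field_eq:
  fixes y :: 'a
  assumes "y ^ p = y"
  shows "\<exists>n<p. of_nat n = y"
proof -
  define P where "P = Polynomial.monom 1 p - Polynomial.monom (1 :: 'a) 1"
  have "p > 1" using p by (rule prime_gt_1_nat)
  then have "degree P = p"
    unfolding P_def diff_conv_add_uminus by (subst degree_add_eq_left) (auto simp: degree_monom_eq)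
  then have P: "P \<noteq> 0"
    using \<open>p > 1\<close> by auto
  have roots: "{x. poly P x = 0} = {x. x ^ p = x}"
    by (auto simp: P_def poly_monom)
  have "(of_nat n :: 'a) ^ p = of_nat n" for n
  proof (induction n)
    case (Suc n)
    then show ?case
      using freshmans_dream[where 'a = 'a, OF _ refl, of 1 "of_nat n"] p
        prime_char_from_card[OF p card] by simp
  qed (use \<open>p > 1\<close> in simp)
  then have sub: "of_nat ` {..<p} \<subseteq> {x :: 'a. x ^ p = x}"
    by auto
  have "card (of_nat ` {..<p} :: 'a set) = p"
    using of_nat_inj_below_char by (subst card_image) (auto simp: inj_on_def)
  moreover have "card {x :: 'a. x ^ p = x} \<le> p"
    using card_poly_roots_bound[OF P] \<open>degree P = p\<close> by (simp add: roots)
  ultimately have "of_nat ` {..<p} = {x :: 'a. x ^ p = x}"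
    using sub by (intro card_seteq) auto
  then have "y \<in> of_nat ` {..<p}"
    using assms by simp
  then show ?thesis
    by auto
qed

text \<open>As a polynomial the trace is nonzero of degree at most p^(r-1), so it has fewer roots
  than the field has elements.\<close>

lemma field_trace_nonzero: "\<exists>x. tr x \<noteq> 0"
proof (rule ccontr)
  assume "\<not> ?thesis"
  then have tr0: "tr x = 0" for x by blast
  define P where "P = (\<Sum>i<r. Polynomial.monom (1 :: 'a) (p ^ i))"
  have "p > 1" using p by (rule prime_gt_1_nat)
  have "poly.coeff P (p ^ 0) = (\<Sum>i<r. if i = 0 then 1 else 0)"
    unfolding P_def coeff_sum coeff_monom using \<open>p > 1\<close> by (intro sum.cong) auto
  then have P: "P \<noteq> 0"
    using r_pos by auto
  have "degree P \<le> p ^ (r - 1)"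
    unfolding P_def using \<open>p > 1\<close>
    by (intro degree_sum_le) (auto simp: degree_monom_eq intro!: power_increasing)
  also have "\<dots> < p ^ r"
    using \<open>p > 1\<close> r_pos by (intro power_strict_increasing) auto
  finally have "degree P < CARD('a)"
    by (simp add: card)
  moreover have "{x. poly P x = 0} = UNIV"
    using tr0 by (auto simp: P_def poly_sum poly_monom field_trace_def)
  ultimately show False
    using card_poly_roots_bound[OF P] by simp
qed

lemma additive_character_add_char:
  assumes \<zeta>: "primitive_root_of_unity p \<zeta>"
  shows "additive_character (add_char \<zeta> p r :: 'a \<Rightarrow> complex)"
proof -
  define n where "n x = (THE n. n < p \<and> of_nat n = tr x)" for x
  \<comment> \<open>The description in \<open>add_char\<close> has a unique solution: the trace lies
    in the prime field, and representatives below \<open>p\<close> are unique.\<close>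
  have n: "n x < p \<and> of_nat (n x) = tr x" for x
    unfolding n_def
  proof (rule theI')
    show "\<exists>!n. n < p \<and> of_nat n = tr x"
      using prime_field_eq[OF field_trace_power[of x]] of_nat_inj_below_char by metis
  qed
  have val: "add_char \<zeta> p r x = \<zeta> ^ n x" for x :: 'a
    by (simp add: add_char_def n_def)
  have \<zeta>mod: "\<zeta> ^ i = \<zeta> ^ (i mod p)" for i
  proof -
    have "\<zeta> ^ i = \<zeta> ^ (i mod p + p * (i div p))" by simp
    also have "\<dots> = \<zeta> ^ (i mod p)"
      using \<zeta> unfolding power_add power_mult by (simp add: primitive_root_of_unity_def)
    finally show ?thesis .
  qed
  show ?thesis
  proof
    fix x y :: 'a
    have "of_nat (n (x + y)) = (of_nat (n x + n y) :: 'a)"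
      using n by (simp add: field_trace_add)
    then have "n (x + y) mod p = (n x + n y) mod p"
      using of_nat_eq_iff_cong_CHAR[where 'a = 'a] prime_char_from_card[OF p card]
      by (metis cong_def)
    then show "add_char \<zeta> p r (x + y) = add_char \<zeta> p r x * add_char \<zeta> p r y"
      using \<zeta>mod by (metis val power_add)
  next
    obtain x :: 'a where x: "tr x \<noteq> 0"
      using field_trace_nonzero by blast
    then have "n x \<noteq> 0"
      using n[of x] by (metis of_nat_0)
    then have "add_char \<zeta> p r x \<noteq> 1"
      using \<zeta> n[of x] by (simp add: val primitive_root_of_unity_def)
    then show "\<exists>x::'a. add_char \<zeta> p r x \<noteq> 1" ..
  next
    have "tr 0 = 0"
      using field_trace_add[of 0 0] by (metis add_0 add_cancel_right_right)
    then have "n 0 = 0"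
      using n[of 0] of_nat_inj_below_char[of "n 0" 0] p by (simp add: prime_gt_0_nat)
    then show "add_char \<zeta> p r (0 :: 'a) = 1"
      by (simp add: val)
  qed
qed

end

section \<open>Series as character sums\<close>

lemma sum_mult_char_divide:
  fixes u :: "'a::{field,finite}"
  assumes "u \<noteq> 0"
  shows "(\<Sum>w\<in>UNIV. f w * (\<Sum>\<chi>\<in>UNIV. char_at \<chi> (u / w))) = (of_nat CARD('a) - 1) * f u"
proof -
  have "(\<Sum>w\<in>UNIV. f w * (\<Sum>\<chi>\<in>UNIV. char_at \<chi> (u / w))) =
      (\<Sum>w\<in>UNIV. if w = u then f w * (of_nat CARD('a) - 1) else 0)"
    by (intro sum.cong refl) (use assms in \<open>auto simp add: sum_mult_char simp del: char_at_1\<close>)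
  then show ?thesis
    by (simp add: mult.commute)
qed

lemma char_at_minus_1_square: "char_at A (-1) * char_at A (-1) = 1"
  by (simp flip: char_at_mult_arg)

text \<open>Reflection rewrites each binomial as a Jacobi sum with \<chi> in one factor only:
  inverse \<chi> at \<open>w\<close>, and \<chi> at \<open>y\<close>. The sum over \<chi> then
  forces \<open>w = x * y\<close>.\<close>

lemma greene_F_2F1_eq_sum:
  fixes A B C :: "'a::{field,finite} mult_char" and x :: 'a
  assumes "x \<noteq> 0"
  shows "greene_F A [B] [C] x =
    char_at (B * C) (-1) / of_nat CARD('a) *
      (\<Sum>y\<in>UNIV. char_at B y * char_at (C * char_inv B) (1 - y) * char_at (char_inv A) (1 - x * y))"
proof -
  define q where "q = (of_nat CARD('a) :: complex)"
  have q: "q \<noteq> 0" "q - 1 \<noteq> 0"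
    using card_field_gt_1[where 'a = 'a] by (simp_all add: q_def)
  define h where "h y = char_at B y * char_at (C * char_inv B) (1 - y)" for y
  have summand: "char_binom (A * \<chi>) \<chi> * char_binom (B * \<chi>) (C * \<chi>) * char_at \<chi> x =
      char_at (B * C) (-1) / q ^ 2 *
        (\<Sum>y\<in>UNIV. \<Sum>w\<in>UNIV. h y * char_at (char_inv A) (1 - w) * char_at \<chi> (x * y / w))" for \<chi>
  proof -
    have 1: "char_inv (char_inv \<chi> * (A * \<chi>)) = char_inv A"
      by (simp add: mult.commute[of A])
    have 2: "char_inv (B * \<chi> * char_inv (C * \<chi>)) = C * char_inv B"
      by (rule mult_char_eqI) (simp add: char_at_simps field_simps)
    have "char_binom (A * \<chi>) \<chi> =
        char_at \<chi> (-1) / q * (char_at (char_inv \<chi>) (-1) * jacobi_sum (char_inv \<chi>) (char_inv A))"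
      using jacobi_sum_reflect[of "char_inv \<chi>" "A * \<chi>"]
      by (simp only: char_binom_eq_jacobi_sum jacobi_sum_commute[of "A * \<chi>"] 1 q_def)
    also have "\<dots> = jacobi_sum (char_inv \<chi>) (char_inv A) / q"
      by (simp add: char_at_char_inv)
    also have "\<dots> = (\<Sum>w\<in>UNIV. char_at (char_inv \<chi>) w * char_at (char_inv A) (1 - w)) / q"
      by (simp add: jacobi_sum_def)
    finally have b1: "char_binom (A * \<chi>) \<chi> = \<dots>" .
    have "char_binom (B * \<chi>) (C * \<chi>) =
        char_at (C * \<chi>) (-1) / q * (char_at (B * \<chi>) (-1) * jacobi_sum (B * \<chi>) (C * char_inv B))"
      using jacobi_sum_reflect[of "B * \<chi>" "char_inv (C * \<chi>)"]
      by (simp only: char_binom_eq_jacobi_sum 2 q_def)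
    also have "\<dots> = char_at (B * C) (-1) / q * jacobi_sum (B * \<chi>) (C * char_inv B)"
      using char_at_minus_1_square[of \<chi>] by (simp add: char_at_times)
    also have "\<dots> = char_at (B * C) (-1) / q * (\<Sum>y\<in>UNIV. h y * char_at \<chi> y)"
      by (simp add: jacobi_sum_def h_def char_at_times[of B] mult_ac)
    finally have b2: "char_binom (B * \<chi>) (C * \<chi>) = \<dots>" .
    have "char_binom (A * \<chi>) \<chi> * char_binom (B * \<chi>) (C * \<chi>) * char_at \<chi> x =
        char_at (B * C) (-1) / q ^ 2 * ((\<Sum>y\<in>UNIV. h y * char_at \<chi> y) *
          (\<Sum>w\<in>UNIV. char_at (char_inv \<chi>) w * char_at (char_inv A) (1 - w)) * char_at \<chi> x)"
      by (simp add: b1 b2 power2_eq_square)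
    also have "(\<Sum>y\<in>UNIV. h y * char_at \<chi> y) *
          (\<Sum>w\<in>UNIV. char_at (char_inv \<chi>) w * char_at (char_inv A) (1 - w)) * char_at \<chi> x =
        (\<Sum>y\<in>UNIV. \<Sum>w\<in>UNIV. h y * char_at (char_inv A) (1 - w) * char_at \<chi> (x * y / w))"
      by (simp add: sum_product sum_distrib_left sum_distrib_right char_at_simps divide_inverse mult_ac)
        (rule sum.swap)
    finally show ?thesis .
  qed
  have "greene_F A [B] [C] x = q / (q - 1) *
      (\<Sum>\<chi>\<in>UNIV. char_at (B * C) (-1) / q ^ 2 *
        (\<Sum>y\<in>UNIV. \<Sum>w\<in>UNIV. h y * char_at (char_inv A) (1 - w) * char_at \<chi> (x * y / w)))"
    by (simp add: greene_F_def q_def[symmetric] summand)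
  also have "\<dots> = char_at (B * C) (-1) / (q * (q - 1)) *
      (\<Sum>\<chi>\<in>UNIV. \<Sum>y\<in>UNIV. \<Sum>w\<in>UNIV. h y * char_at (char_inv A) (1 - w) * char_at \<chi> (x * y / w))"
    unfolding sum_distrib_left[symmetric] using q by (simp add: power2_eq_square)
  also have "(\<Sum>\<chi>\<in>UNIV. \<Sum>y\<in>UNIV. \<Sum>w\<in>UNIV. h y * char_at (char_inv A) (1 - w) * char_at \<chi> (x * y / w)) =
      (\<Sum>y\<in>UNIV. \<Sum>\<chi>\<in>UNIV. \<Sum>w\<in>UNIV. h y * char_at (char_inv A) (1 - w) * char_at \<chi> (x * y / w))"
    by (rule sum.swap)
  also have "\<dots> = (\<Sum>y\<in>UNIV. h y * (\<Sum>w\<in>UNIV. char_at (char_inv A) (1 - w) * (\<Sum>\<chi>\<in>UNIV. char_at \<chi> (x * y / w))))"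
    unfolding sum_distrib_left mult.assoc by (intro sum.cong refl sum.swap)
  also have "\<dots> = (\<Sum>y\<in>UNIV. (q - 1) * (h y * char_at (char_inv A) (1 - x * y)))"
  proof (rule sum.cong)
    fix y :: 'a
    show "h y * (\<Sum>w\<in>UNIV. char_at (char_inv A) (1 - w) * (\<Sum>\<chi>\<in>UNIV. char_at \<chi> (x * y / w))) =
        (q - 1) * (h y * char_at (char_inv A) (1 - x * y))"
    proof (cases "y = 0")
      case False
      then show ?thesis
        using assms by (subst sum_mult_char_divide) (simp_all add: q_def)
    qed (simp add: h_def)
  qed simp
  finally show ?thesis
    using q by (simp add: h_def q_def flip: sum_distrib_left)
qed

lemma sum_char_at_remove:
  assumes "A \<noteq> 1"
  shows "(\<Sum>x\<in>UNIV-{u}. char_at A x) = - char_at A u"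
  using sum_char_at_eq_0[OF assms] by (subst (asm) sum.remove[of UNIV u]) (auto simp: add_eq_0_iff)

text \<open>For nonzero \<open>c\<close>, \<open>y / (c - y)\<close> takes every value except -1
  exactly once on the complement of \<open>c\<close>. For \<open>c = 0\<close> it is -1 at every
  nonzero \<open>y\<close>; this degeneration is the source of the delta term.\<close>

lemma sum_char_at_moebius:
  fixes A :: "'a::{field,finite} mult_char" and c :: 'a
  assumes "A \<noteq> 1" "char_at A (-1) = 1"
  shows "(\<Sum>y\<in>UNIV. char_at A (y / (c - y))) = (if c = 0 then of_nat CARD('a) - 1 else -1)"
proof (cases "c = 0")
  case True
  then have "char_at A (y / (c - y)) = (if y = 0 then 0 else 1)" for y
    using assms(2) by simp
  then have "(\<Sum>y\<in>UNIV. char_at A (y / (c - y))) = (\<Sum>y\<in>UNIV. char_at (1 :: 'a mult_char) y)"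
    by (simp add: char_at_one)
  then show ?thesis
    using True sum_char_at_one[where 'a = 'a] by simp
next
  case False
  have "(\<Sum>y\<in>UNIV. char_at A (y / (c - y))) = (\<Sum>y\<in>UNIV - {c}. char_at A (y / (c - y)))"
    by (rule sum.mono_neutral_right) auto
  also have "\<dots> = (\<Sum>x\<in>UNIV - {-1}. char_at A x)"
  proof (rule sum.reindex_bij_witness[of _ "\<lambda>x. c * x / (1 + x)" "\<lambda>y. y / (c - y)"])
    fix y
    assume "y \<in> UNIV - {c}"
    then have "1 + y / (c - y) = c / (c - y)" "c - y \<noteq> 0"
      by (auto simp: field_simps)
    then show "c * (y / (c - y)) / (1 + y / (c - y)) = y" "y / (c - y) \<in> UNIV - {-1}"
      using False by (auto simp: add_eq_0_iff)
  next
    fix x :: 'a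
    assume "x \<in> UNIV - {-1}"
    then have "1 + x \<noteq> 0"
      by (auto simp: add_eq_0_iff)
    then have "c - c * x / (1 + x) = c / (1 + x)"
      by (simp add: field_simps)
    then show "c * x / (1 + x) / (c - c * x / (1 + x)) = x" "c * x / (1 + x) \<in> UNIV - {c}"
      using False \<open>1 + x \<noteq> 0\<close> by auto
  qed simp
  finally show ?thesis
    using False sum_char_at_remove[OF assms(1), of "-1"] assms by simp
qed

section \<open>The product of the two series\<close>

text \<open>That the characters are squares is used here only through their value at -1. Each
  inequality between characters makes one curve sum harmless: \<open>d_neq_e\<close> and
  \<open>a\<close> for the two lines, \<open>d_neq_a\<close> for the hyperbola s t z^2 = 1,
  \<open>e\<close> for the antidiagonal, \<open>a_neq_de\<close> for the hyperbola s t z =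
  1.\<close>

locale series_product =
  fixes a d e :: "'a::{field,finite} mult_char" and z :: 'a
  assumes even: "char_at a (-1) = 1" "char_at d (-1) = 1" "char_at e (-1) = 1"
    and a: "a \<noteq> 1" and e: "e \<noteq> 1" and d_neq_a: "d \<noteq> a" and d_neq_e: "d \<noteq> e"
    and a_neq_de: "a \<noteq> d * e"
    and z: "z \<noteq> 0" "z \<noteq> 1"
begin

text \<open>
  \<open>kernel s t\<close> is \<open>integrand y w\<close> in the variables \<open>s = (1 - w) / (1 - z * y)\<close> and
  \<open>t = (1 - y) / (1 - z * w)\<close>, since then
  \<open>y / w = (1 - s * t * z - t * (1 - z)) / (1 - s * t * z - s * (1 - z))\<close>. Both vanish where a
  denominator does, because \<open>x / 0 = 0\<close> and characters vanish at 0.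
\<close>

definition kernel :: "'a \<Rightarrow> 'a \<Rightarrow> complex" where
  "kernel s t =
     char_at e ((1 - s * t * z - t * (1 - z)) / (1 - s * t * z - s * (1 - z))) *
       char_at (d * char_inv e) t * char_at a s"

definition integrand :: "'a \<Rightarrow> 'a \<Rightarrow> complex" where
  "integrand y w =
     char_at e (y / w) * char_at (d * char_inv e) ((1 - y) / (1 - z * w)) *
       char_at a ((1 - w) / (1 - z * y))"

lemma kernel_eq_0: "s = 0 \<or> t = 0 \<Longrightarrow> kernel s t = 0"
  by (auto simp: kernel_def)

text \<open>The factors of \<open>kernel\<close> with \<open>a\<close> and
  \<open>d * char_inv e\<close> at s = t = -1/z, the signs dropped by evenness; the quotient inside
  \<open>e\<close> is 0/0 there.\<close>

definition \<kappa> :: complex where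
  "\<kappa> = char_at a (1 / z) * char_at (d * char_inv e) (1 / z)"

lemma char_at_neg_inverse_z:
  "char_at a (- (1 / z)) = char_at a (1 / z)"
  "char_at (d * char_inv e) (- (1 / z)) = char_at (d * char_inv e) (1 / z)"
  using even char_at_uminus_arg[of a "1 / z"] char_at_uminus_arg[of "d * char_inv e" "1 / z"]
  by (simp_all add: char_at_simps)

lemma d_inv_e_neq_1: "d * char_inv e \<noteq> 1"
  using d_neq_e by (simp add: mult_char_mult_inv_eq_1_iff)

section \<open>The kernel on the degenerate curves\<close>

lemma kernel_s: "t \<noteq> - (1 / z) \<Longrightarrow> kernel (- (1 / z)) t = char_at e z * char_at a (1 / z) * char_at (d * char_inv e) t"
proof -
  assume "t \<noteq> - (1 / z)"
  then have nz: "1 + t * z \<noteq> 0"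
    using z by (auto simp: field_simps add_eq_0_iff)
  have eqs: "1 - (- (1 / z)) * t * z - t * (1 - z) = 1 + t * z"
    "1 - (- (1 / z)) * t * z - (- (1 / z)) * (1 - z) = (1 + t * z) / z"
    using z by (simp_all add: field_simps)
  have ratio: "(1 + t * z) / ((1 + t * z) / z) = z"
    using nz z by simp
  show ?thesis
    by (simp only: kernel_def eqs ratio char_at_neg_inverse_z) (simp only: mult_ac)
qed

lemma kernel_t: "s \<noteq> - (1 / z) \<Longrightarrow> kernel s (- (1 / z)) = char_at e (1 / z) * char_at (d * char_inv e) (1 / z) * char_at a s"
proof -
  assume "s \<noteq> - (1 / z)"
  then have nz: "1 + s * z \<noteq> 0"
    using z by (auto simp: field_simps add_eq_0_iff)
  have eqs: "1 - s * (- (1 / z)) * z - s * (1 - z) = 1 + s * z"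
    "1 - s * (- (1 / z)) * z - (- (1 / z)) * (1 - z) = (1 + s * z) / z"
    using z by (simp_all add: field_simps)
  have ratio: "(1 + s * z) / ((1 + s * z) / z) = z" "((1 + s * z) / z) / (1 + s * z) = 1 / z"
    using nz z by simp_all
  show ?thesis
    by (simp only: kernel_def eqs ratio char_at_neg_inverse_z)
qed

lemma kernel_hyperbola:
  assumes "t \<noteq> 0"
  shows "kernel (1 / (t * z ^ 2)) t =
    (if t = - (1 / z) then 0 else char_at e z * char_at a (1 / z ^ 2) * char_at (d * char_inv a) t)"
proof (cases "t = - (1 / z)")
  case True
  have "1 - 1 / (t * z ^ 2) * t * z - t * (1 - z) = 0"
    using z by (simp add: True field_simps power2_eq_square)
  then show ?thesis
    using True by (simp add: kernel_def)
next
  case False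
  then have t: "1 + t * z \<noteq> 0"
    using z by (auto simp: field_simps add_eq_0_iff)
  have 1: "1 - 1 / (t * z ^ 2) * t * z - t * (1 - z) = - ((1 - z) * (1 + t * z) / z)"
    "1 - 1 / (t * z ^ 2) * t * z - 1 / (t * z ^ 2) * (1 - z) = - ((1 - z) * (1 + t * z) / (t * z ^ 2))"
    using z assms by (simp_all add: field_simps power2_eq_square)
  have "(- ((1 - z) * (1 + t * z) / z)) / (- ((1 - z) * (1 + t * z) / (t * z ^ 2))) = t * z"
    using z assms t by (simp add: power2_eq_square)
  then have "kernel (1 / (t * z ^ 2)) t =
      char_at e (t * z) * char_at (d * char_inv e) t * char_at a (1 / (t * z ^ 2))"
    by (simp only: kernel_def 1)
  then show ?thesis
    using False assms z by (simp add: char_at_simps field_simps)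
qed

lemma kappa_eq:
  "char_at e z * char_at a (1 / z ^ 2) * char_at (d * char_inv a) (1 / z) = \<kappa>"
  using z by (simp add: \<kappa>_def char_at_simps field_simps power2_eq_square)

text \<open>The pairs \<open>(s, t)\<close> of nonzero elements that come from exactly one \<open>(y, w)\<close>.\<close>

definition generic :: "('a \<times> 'a) set" where
  "generic = {(s, t). s \<noteq> 0 \<and> t \<noteq> 0 \<and> s * t * z ^ 2 \<noteq> 1 \<and> s \<noteq> - (1 / z) \<and> t \<noteq> - (1 / z)}"

lemma sum_kernel:
  "(\<Sum>(s, t)\<in>UNIV. kernel s t) =
     (\<Sum>(s, t)\<in>generic. kernel s t) - \<kappa> * (char_at e z + char_at e (1 / z) + 1)"
proof -
  define k where "k = - (1 / z)"
  have k: "k \<noteq> 0" using z by (simp add: k_def)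
  have on_curve: "s * t * z ^ 2 = 1 \<longleftrightarrow> t \<noteq> 0 \<and> s = 1 / (t * z ^ 2)" for s t
    using z by (auto simp: eq_divide_eq mult.assoc)
  have kk: "k * k * z ^ 2 = 1"
    using z by (simp add: k_def power2_eq_square)
  have "k * t * z ^ 2 = k * k * z ^ 2 \<longleftrightarrow> t = k" for t
    using k z by simp
  then have kt: "k * t * z ^ 2 = 1 \<longleftrightarrow> t = k" for t
    by (simp only: kk)
  have tk: "t * k * z ^ 2 = 1 \<longleftrightarrow> t = k" for t
    using kt[of t] by (simp add: mult.commute)
  have hyperbola: "kernel (1 / (t * z ^ 2)) t =
      (if t = k then 0 else char_at e z * char_at a (1 / z ^ 2) * char_at (d * char_inv a) t)"
    if "t \<noteq> 0" for t
    unfolding k_def using that by (rule kernel_hyperbola)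
  \<comment> \<open>The three curves meet only in \<open>(k, k)\<close>. Leaving this point to
    \<open>Q3\<close> alone makes the sets disjoint, and the kernel vanishes there.\<close>
  define Q1 where "Q1 = Pair k ` (UNIV - {k})"
  define Q2 where "Q2 = (\<lambda>s. (s, k)) ` (UNIV - {k})"
  define Q3 where "Q3 = (\<lambda>t. (1 / (t * z ^ 2), t)) ` (UNIV - {0})"
  let ?f = "\<lambda>(s, t). kernel s t"
  have mem_Q3: "p \<in> Q3 \<longleftrightarrow> fst p * snd p * z ^ 2 = 1" for p
    unfolding Q3_def by (cases p) (auto simp: on_curve image_iff)
  have "(\<Sum>p\<in>UNIV. ?f p) = (\<Sum>p\<in>generic \<union> (Q1 \<union> Q2 \<union> Q3). ?f p)"
  proof (rule sum.mono_neutral_right)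
    show "\<forall>p\<in>UNIV - (generic \<union> (Q1 \<union> Q2 \<union> Q3)). ?f p = 0"
    proof
      fix p
      assume p: "p \<in> UNIV - (generic \<union> (Q1 \<union> Q2 \<union> Q3))"
      obtain s t where st: "p = (s, t)" by (cases p)
      then have "s * t * z ^ 2 \<noteq> 1"
        using p mem_Q3[of p] by (auto simp: st)
      then have "s = 0 \<or> t = 0"
        using p kk by (auto simp: st generic_def Q1_def Q2_def image_iff k_def[symmetric])
      then show "?f p = 0"
        by (auto simp: st kernel_eq_0)
    qed
  qed auto
  also have "\<dots> = (\<Sum>p\<in>generic. ?f p) + (\<Sum>p\<in>Q1 \<union> Q2 \<union> Q3. ?f p)"
    by (rule sum.union_disjoint) (auto simp: mem_Q3 Q1_def Q2_def generic_def k_def)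
  also have "(\<Sum>p\<in>Q1 \<union> Q2 \<union> Q3. ?f p) = (\<Sum>p\<in>Q1 \<union> Q2. ?f p) + (\<Sum>p\<in>Q3. ?f p)"
  proof (rule sum.union_disjoint)
    have "p \<notin> Q3" if "p \<in> Q1 \<union> Q2" for p
      using that by (auto simp: mem_Q3 Q1_def Q2_def kt tk)
    then show "(Q1 \<union> Q2) \<inter> Q3 = {}"
      by blast
  qed auto
  also have "(\<Sum>p\<in>Q1 \<union> Q2. ?f p) = (\<Sum>p\<in>Q1. ?f p) + (\<Sum>p\<in>Q2. ?f p)"
    by (rule sum.union_disjoint) (auto simp: Q1_def Q2_def)
  also have "(\<Sum>p\<in>Q1. ?f p) = (\<Sum>t\<in>UNIV-{k}. kernel k t)"
    unfolding Q1_def by (subst sum.reindex) (auto simp: inj_on_def)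
  also have "\<dots> = char_at e z * char_at a (1 / z) * (\<Sum>t\<in>UNIV-{k}. char_at (d * char_inv e) t)"
    unfolding sum_distrib_left by (intro sum.cong) (auto simp: k_def kernel_s)
  also have "\<dots> = - (\<kappa> * char_at e z)"
    unfolding sum_char_at_remove[OF d_inv_e_neq_1] by (simp add: k_def char_at_neg_inverse_z \<kappa>_def)
  also have "(\<Sum>p\<in>Q2. ?f p) = (\<Sum>s\<in>UNIV-{k}. kernel s k)"
    unfolding Q2_def by (subst sum.reindex) (auto simp: inj_on_def)
  also have "\<dots> = char_at e (1 / z) * char_at (d * char_inv e) (1 / z) * (\<Sum>s\<in>UNIV-{k}. char_at a s)"
    unfolding sum_distrib_left by (intro sum.cong) (auto simp: k_def kernel_t)
  also have "\<dots> = - (\<kappa> * char_at e (1 / z))"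
    unfolding sum_char_at_remove[OF a] by (simp add: k_def char_at_neg_inverse_z \<kappa>_def)
  also have "(\<Sum>p\<in>Q3. ?f p) = (\<Sum>t\<in>UNIV-{0}. kernel (1 / (t * z ^ 2)) t)"
    unfolding Q3_def by (subst sum.reindex) (auto simp: inj_on_def)
  also have "\<dots> = (\<Sum>t\<in>UNIV-{k}. char_at e z * char_at a (1 / z ^ 2) * char_at (d * char_inv a) t)"
    \<comment> \<open>The index sets differ in two harmless points: the left-hand term is 0 at
      \<open>t = k\<close>, the right-hand one at \<open>t = 0\<close>.\<close>
    by (rule sum.mono_neutral_cong) (use k in \<open>auto simp: hyperbola\<close>)
  also have "\<dots> = - \<kappa>"
  proof -
    have "d * char_inv a \<noteq> 1"
      using d_neq_a by (simp add: mult_char_mult_inv_eq_1_iff)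
    moreover have "char_at (d * char_inv a) k = char_at (d * char_inv a) (1 / z)"
      using even char_at_uminus_arg[of "d * char_inv a" "1 / z"] by (simp add: k_def char_at_simps)
    ultimately show ?thesis
      unfolding sum_distrib_left[symmetric] by (simp add: sum_char_at_remove kappa_eq[symmetric])
  qed
  finally show ?thesis
    by (simp add: case_prod_unfold algebra_simps)
qed

text \<open>This line is collapsed to the single point \<open>s = t = - 1 / z\<close>.\<close>

definition antidiagonal :: "('a \<times> 'a) set" where
  "antidiagonal = {(y, w). y + w = 1 + 1 / z}"

lemma sum_integrand_antidiagonal:
  "(\<Sum>(y, w)\<in>antidiagonal. integrand y w) =
     (if z = -1 then of_nat CARD('a) else 0) - \<kappa> * (char_at e z + char_at e (1 / z) + 1)"
proof -
  define c where "c = 1 + 1 / z"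
  have c0: "c = 0 \<longleftrightarrow> z = -1"
    using z by (auto simp: c_def field_simps add_eq_0_iff)
  have ne: "(1 :: 'a) \<noteq> 1 / z" using z by simp
  have anti: "antidiagonal = (\<lambda>y. (y, c - y)) ` UNIV"
    by (auto simp: antidiagonal_def c_def[symmetric] image_iff algebra_simps)
  \<comment> \<open>On this line both quotients \<open>s\<close> and \<open>t\<close> equal -1/z
    wherever they are defined and nonzero, so only \<open>e\<close> at y/w varies.\<close>
  have val: "integrand y (c - y) =
      (if y = 1 \<or> y = 1 / z then 0 else \<kappa> * char_at e (y / (c - y)))" for y
  proof -
    have 1: "1 - z * (c - y) = z * (y - 1)" "1 - (c - y) = (z * y - 1) / z"
      using z by (simp_all add: c_def field_simps)
    show ?thesis
    proof (cases "y = 1 \<or> y = 1 / z")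
      case True
      then show ?thesis
        unfolding integrand_def 1 using z by auto
    next
      case False
      then have "y - 1 \<noteq> 0" "1 - z * y \<noteq> 0"
        using z by (auto simp: field_simps)
      then have "(1 - y) / (z * (y - 1)) = - (1 / z)" "(z * y - 1) / z / (1 - z * y) = - (1 / z)"
        using z by (simp_all add: field_simps)
      then show ?thesis
        unfolding integrand_def 1 using False
        by (simp add: char_at_neg_inverse_z \<kappa>_def)
    qed
  qed
  have "(\<Sum>(y, w)\<in>antidiagonal. integrand y w) = (\<Sum>y\<in>UNIV. integrand y (c - y))"
    unfolding anti by (subst sum.reindex) (auto simp: inj_on_def)
  also have "\<dots> = (\<Sum>y\<in>UNIV - {1} - {1 / z}. \<kappa> * char_at e (y / (c - y)))"
    by (rule sum.mono_neutral_cong_right) (auto simp: val)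
  also have "\<dots> = \<kappa> * ((\<Sum>y\<in>UNIV. char_at e (y / (c - y))) - char_at e (1 / (c - 1)) - char_at e (1 / z / (c - 1 / z)))"
    unfolding sum_distrib_left[symmetric]
    by (subst sum.remove[of UNIV 1], simp, simp, subst sum.remove[of "UNIV - {1}" "1 / z"])
       (use ne in auto)
  also have "\<dots> = \<kappa> * ((if z = -1 then of_nat CARD('a) else 0) - 1 - char_at e z - char_at e (1 / z))"
  proof -
    have "c - 1 = 1 / z" "c - 1 / z = 1"
      by (simp_all add: c_def)
    then show ?thesis
      by (simp add: sum_char_at_moebius[OF e even(3)] c0)
  qed
  \<comment> \<open>For z = -1 evenness gives \<kappa> = 1, so the extra term is exactly q.\<close>
  also have "\<dots> = (if z = -1 then of_nat CARD('a) else 0) - \<kappa> * (char_at e z + char_at e (1 / z) + 1)"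
    using even by (auto simp: \<kappa>_def char_at_simps algebra_simps)
  finally show ?thesis .
qed

text \<open>The inverse \<open>G\<close> solves the linear system 1-w = s(1-zy), 1-y = t(1-zw),
  whose determinant is 1-stz^2. Pairs with \<open>y\<close> or \<open>w\<close> in {1, 1/z} drop out
  because a numerator or denominator of the integrand is 0.\<close>

lemma sum_integrand_eq_sum_generic:
  "(\<Sum>(y, w)\<in>UNIV - antidiagonal. integrand y w) = (\<Sum>(s, t)\<in>generic. kernel s t)"
proof -
  let ?P = "{(y, w). y + w \<noteq> 1 + 1 / z \<and> y \<noteq> 1 \<and> y \<noteq> 1 / z \<and> w \<noteq> 1 \<and> w \<noteq> 1 / z}"
  define F where "F = (\<lambda>(y, w). ((1 - w) / (1 - z * y), (1 - y) / (1 - z * w)))"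
  define G where "G = (\<lambda>(s, t). ((1 - s * t * z - t * (1 - z)) / (1 - s * t * z ^ 2),
                            (1 - s * t * z - s * (1 - z)) / (1 - s * t * z ^ 2)))"
  have F: "G (F (y, w)) = (y, w) \<and> F (y, w) \<in> generic \<and> case_prod kernel (F (y, w)) = integrand y w"
    if yw: "y + w \<noteq> 1 + 1 / z" "y \<noteq> 1" "y \<noteq> 1 / z" "w \<noteq> 1" "w \<noteq> 1 / z" for y w
  proof -
    define Y where "Y = 1 - z * y"
    define W where "W = 1 - z * w"
    define S where "S = (1 - w) / Y"
    define T where "T = (1 - y) / W"
    have nz: "Y \<noteq> 0" "W \<noteq> 0"
      using yw z by (auto simp: Y_def W_def field_simps)
    \<comment> \<open>This vanishes exactly on the antidiagonal, and it divides both numerators and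
      the determinant of \<open>G\<close>.\<close>
    have N: "z + 1 - z * (y + w) \<noteq> 0"
      using yw z by (auto simp: field_simps)
    have D: "1 - S * T * z ^ 2 = (1 - z) * (z + 1 - z * (y + w)) / (Y * W)"
      unfolding S_def T_def using nz
      by (simp add: field_simps) (simp add: Y_def W_def algebra_simps power2_eq_square)
    have A: "1 - S * T * z - T * (1 - z) = y * ((1 - z) * (z + 1 - z * (y + w)) / (Y * W))"
      unfolding S_def T_def using nz
      by (simp add: field_simps) (simp add: Y_def W_def algebra_simps power2_eq_square)
    have B: "1 - S * T * z - S * (1 - z) = w * ((1 - z) * (z + 1 - z * (y + w)) / (Y * W))"
      unfolding S_def T_def using nz
      by (simp add: field_simps) (simp add: Y_def W_def algebra_simps power2_eq_square)
    have Dnz: "(1 - z) * (z + 1 - z * (y + w)) / (Y * W) \<noteq> 0"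
      using nz N z by simp
    have "(1 - S * T * z - T * (1 - z)) / (1 - S * T * z ^ 2) = y"
      "(1 - S * T * z - S * (1 - z)) / (1 - S * T * z ^ 2) = w"
      unfolding A B D using Dnz by simp_all
    then have "G (S, T) = (y, w)"
      by (simp only: G_def prod.case)
    moreover have "S \<noteq> 0" "T \<noteq> 0"
      using yw nz by (auto simp: S_def T_def)
    moreover have "S * T * z ^ 2 \<noteq> 1"
      using D Dnz by auto
    moreover have "S \<noteq> - (1 / z)" "T \<noteq> - (1 / z)"
      using nz N z by (auto simp: S_def T_def Y_def W_def field_simps)
    moreover have "kernel S T = integrand y w"
      unfolding kernel_def integrand_def A B using Dnz by (simp add: S_def T_def Y_def W_def)
    moreover have "F (y, w) = (S, T)"
      by (simp add: F_def S_def T_def Y_def W_def)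
    ultimately show ?thesis
      by (simp add: generic_def)
  qed
  have G: "F (G (s, t)) = (s, t) \<and> G (s, t) \<in> ?P" if "(s, t) \<in> generic" for s t
  proof -
    have st: "s \<noteq> 0" "t \<noteq> 0" "1 - s * t * z ^ 2 \<noteq> 0" "1 + s * z \<noteq> 0" "1 + t * z \<noteq> 0"
      using that z by (auto simp: generic_def field_simps add_eq_0_iff)
    define M where "M = 1 - s * t * z ^ 2"
    define y where "y = (1 - s * t * z - t * (1 - z)) / M"
    define w where "w = (1 - s * t * z - s * (1 - z)) / M"
    have M: "M \<noteq> 0" using st by (simp add: M_def)
    \<comment> \<open>The factorisations in \<open>Y\<close>, \<open>W\<close>, \<open>Y1\<close>,
      \<open>W1\<close> and \<open>N\<close> show that the conditions defining
      \<open>generic\<close> are just what keeps (y, w) off the excluded lines.\<close>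
    have Y: "1 - z * y = (1 - z) * (1 + t * z) / M"
      unfolding y_def using M by (simp add: field_simps) (simp add: M_def algebra_simps power2_eq_square)
    have W: "1 - z * w = (1 - z) * (1 + s * z) / M"
      unfolding w_def using M by (simp add: field_simps) (simp add: M_def algebra_simps power2_eq_square)
    have Y1: "1 - y = t * (1 - z) * (1 + s * z) / M"
      unfolding y_def using M by (simp add: field_simps) (simp add: M_def algebra_simps power2_eq_square)
    have W1: "1 - w = s * (1 - z) * (1 + t * z) / M"
      unfolding w_def using M by (simp add: field_simps) (simp add: M_def algebra_simps power2_eq_square)
    have N: "z + 1 - z * (y + w) = (1 - z) * (1 + s * z) * (1 + t * z) / M"
      unfolding y_def w_def using M by (simp add: field_simps) (simp add: M_def algebra_simps power2_eq_square)
    have "G (s, t) = (y, w)"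
      by (simp add: G_def y_def w_def M_def)
    moreover have "(1 - w) / (1 - z * y) = s" "(1 - y) / (1 - z * w) = t"
      unfolding Y W Y1 W1 using M st z by simp_all
    then have "F (y, w) = (s, t)"
      by (simp add: F_def)
    moreover have "1 - z * y \<noteq> 0" "1 - z * w \<noteq> 0" "1 - y \<noteq> 0" "1 - w \<noteq> 0" "z + 1 - z * (y + w) \<noteq> 0"
      unfolding Y W Y1 W1 N using M st z by simp_all
    then have "(y, w) \<in> ?P"
      using z by (auto simp: field_simps)
    ultimately show ?thesis
      by simp
  qed
  have "(\<Sum>(y, w)\<in>UNIV - antidiagonal. integrand y w) = (\<Sum>(y, w)\<in>?P. integrand y w)"
    by (rule sum.mono_neutral_right) (use z in \<open>auto simp: antidiagonal_def integrand_def\<close>)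
  also have "\<dots> = (\<Sum>(s, t)\<in>generic. kernel s t)"
  proof (rule sum.reindex_bij_witness[of _ G F])
    fix p
    assume "p \<in> ?P"
    then obtain y w where p: "p = (y, w)"
      and "y + w \<noteq> 1 + 1 / z" "y \<noteq> 1" "y \<noteq> 1 / z" "w \<noteq> 1" "w \<noteq> 1 / z"
      by blast
    from F[OF this(2-6)] show "G (F p) = p" "F p \<in> generic" "case_prod kernel (F p) = case_prod integrand p"
      by (simp_all add: p)
  next
    fix p
    assume p: "p \<in> generic"
    obtain s t where st: "p = (s, t)" by (cases p)
    with p G[of s t] have "F (G p) = p \<and> G p \<in> ?P"
      by (simp only:)
    then show "F (G p) = p" "G p \<in> ?P"
      by (rule conjunct1, elim conjunct2)
  qed
  finally show ?thesis .
qed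

lemma sum_integrand:
  "(\<Sum>(y, w)\<in>UNIV. integrand y w) =
     (\<Sum>(s, t)\<in>UNIV. kernel s t) + (if z = -1 then of_nat CARD('a) else 0)"
proof -
  have "(\<Sum>(y, w)\<in>UNIV. integrand y w) =
      (\<Sum>(y, w)\<in>UNIV - antidiagonal. integrand y w) + (\<Sum>(y, w)\<in>antidiagonal. integrand y w)"
    by (rule sum.subset_diff) auto
  then show ?thesis
    by (simp add: sum_integrand_eq_sum_generic sum_integrand_antidiagonal sum_kernel)
qed

lemma sum_integrand_eq_prod:
  "(\<Sum>(y, w)\<in>UNIV. integrand y w) =
     (\<Sum>y\<in>UNIV. char_at e y * char_at (d * char_inv e) (1 - y) * char_at (char_inv a) (1 - z * y)) *
     (\<Sum>w\<in>UNIV. char_at (char_inv e) w * char_at a (1 - w) * char_at (char_inv (d * char_inv e)) (1 - z * w))"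
  unfolding sum_product sum.cartesian_product UNIV_Times_UNIV
  by (intro sum.cong) (auto simp: integrand_def char_at_simps divide_inverse mult_ac)

end

section \<open>Mellin expansion and Gauss sums\<close>

lemma sum_product3:
  fixes f :: "'b::finite \<Rightarrow> 'r::comm_semiring_1" and g :: "'c::finite \<Rightarrow> 'r" and h :: "'d::finite \<Rightarrow> 'r"
  shows "sum f UNIV * sum g UNIV * sum h UNIV = (\<Sum>(x, y, w)\<in>UNIV. f x * (g y * h w))"
proof -
  have "sum g UNIV * sum h UNIV = (\<Sum>(y, w)\<in>UNIV. g y * h w)"
    by (simp add: sum_product sum.cartesian_product)
  then have "sum f UNIV * sum g UNIV * sum h UNIV = sum f UNIV * (\<Sum>(y, w)\<in>UNIV. g y * h w)"
    by (simp only: mult.assoc)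
  then show ?thesis
    by (simp add: sum_product sum.cartesian_product case_prod_unfold)
qed

context series_product
begin

text \<open>The next substitution divides by 1-stz, so this curve must be discarded. On it the
  quotient inside \<open>e\<close> is t/s = t^2 z, and the kernel is a constant times the nontrivial
  character \<open>d * e * char_inv a\<close> at \<open>t\<close>.\<close>

lemma sum_kernel_hyperbola:
  "(\<Sum>(s, t)\<in>UNIV. kernel s t) = (\<Sum>(s, t)\<in>{(s, t). s \<noteq> 0 \<and> t \<noteq> 0 \<and> s * t * z \<noteq> 1}. kernel s t)"
proof -
  let ?R = "{(s, t). s \<noteq> 0 \<and> t \<noteq> 0 \<and> s * t * z \<noteq> 1}"
  define H where "H = (\<lambda>t. (1 / (t * z), t)) ` (UNIV - {0})"
  have mem_H: "(s, t) \<in> H \<longleftrightarrow> s * t * z = 1" for s t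
    unfolding H_def using z by (auto simp: image_iff eq_divide_eq mult.assoc)
  have val: "kernel (1 / (t * z)) t = char_at e z / char_at a z * char_at (d * e * char_inv a) t"
    if t: "t \<noteq> 0" for t
  proof -
    have "1 / (t * z) * t * z = 1"
      using t z by simp
    moreover have "(1 - 1 - t * (1 - z)) / (1 - 1 - 1 / (t * z) * (1 - z)) = t * t * z"
      using t z by simp
    ultimately have "kernel (1 / (t * z)) t =
        char_at e (t * t * z) * char_at (d * char_inv e) t * char_at a (1 / (t * z))"
      by (simp only: kernel_def)
    then show ?thesis
      using t z by (simp add: char_at_simps field_simps)
  qed
  have "(\<Sum>(s, t)\<in>H. kernel s t) = (\<Sum>t\<in>UNIV - {0}. kernel (1 / (t * z)) t)"
    unfolding H_def by (subst sum.reindex) (auto simp: inj_on_def)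
  also have "\<dots> = char_at e z / char_at a z * (\<Sum>t\<in>UNIV - {0}. char_at (d * e * char_inv a) t)"
    unfolding sum_distrib_left by (intro sum.cong) (auto simp: val)
  also have "\<dots> = 0"
    using a_neq_de by (subst sum_char_at_remove) (auto simp: mult_char_mult_inv_eq_1_iff)
  finally have H0: "(\<Sum>(s, t)\<in>H. kernel s t) = 0" .
  have "(\<Sum>(s, t)\<in>UNIV. kernel s t) = (\<Sum>(s, t)\<in>?R \<union> H. kernel s t)"
  proof (rule sum.mono_neutral_right)
    show "\<forall>p\<in>UNIV - (?R \<union> H). (case p of (s, t) \<Rightarrow> kernel s t) = 0"
      using mem_H by (auto intro: kernel_eq_0)
  qed auto
  also have "\<dots> = (\<Sum>(s, t)\<in>?R. kernel s t) + (\<Sum>(s, t)\<in>H. kernel s t)"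
    by (rule sum.union_disjoint) (use mem_H in auto)
  finally show ?thesis
    using H0 by simp
qed

lemma sum_kernel_mellin:
  "(of_nat CARD('a) - 1) * (\<Sum>(s, t)\<in>UNIV. kernel s t) =
     (\<Sum>\<chi>\<in>UNIV. char_at \<chi> z * char_at (char_inv (a * d * char_inv e * \<chi> * \<chi>)) (1 - z) *
        (jacobi_sum (char_inv \<chi>) (a * d * char_inv e * \<chi> * \<chi>) *
         jacobi_sum (a * \<chi>) (char_inv e) * jacobi_sum (d * char_inv e * \<chi>) e))"
proof -
  \<comment> \<open>\<open>v = s * t * z\<close>, \<open>S = c * s\<close>, \<open>T = c * t\<close> with \<open>c = (1 - z) / (1 - s * t * z)\<close>
    parametrises the solutions of \<open>\<rho> (v, S, T) = 1\<close>, the only triples left by orthogonality\<close>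
  define wt where "wt = (\<lambda>(v, S, T). char_at (a * d * char_inv e) ((1 - v) / (1 - z)) *
      char_at a S * char_at (d * char_inv e) T * char_at e ((1 - T) / (1 - S)))"
  define \<rho> where "\<rho> = (\<lambda>(v, S, T). z * S * T * (1 - v) ^ 2 / (v * (1 - z) ^ 2))"
  define R where "R = {(s, t). s \<noteq> 0 \<and> t \<noteq> 0 \<and> s * t * z \<noteq> 1}"
  define F where "F = (\<lambda>(v, S, T). (S * (1 - v) / (1 - z), T * (1 - v) / (1 - z)))"
  define G where "G = (\<lambda>(s, t). (s * t * z, s * ((1 - z) / (1 - s * t * z)), t * ((1 - z) / (1 - s * t * z))))"
  have "(\<Sum>\<chi>\<in>UNIV. char_at \<chi> z * char_at (char_inv (a * d * char_inv e * \<chi> * \<chi>)) (1 - z) *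
        (jacobi_sum (char_inv \<chi>) (a * d * char_inv e * \<chi> * \<chi>) *
         jacobi_sum (a * \<chi>) (char_inv e) * jacobi_sum (d * char_inv e * \<chi>) e)) =
      (\<Sum>\<chi>\<in>UNIV. \<Sum>p\<in>UNIV. wt p * char_at \<chi> (\<rho> p))"
  proof (rule sum.cong)
    fix \<chi> :: "'a mult_char"
    have "jacobi_sum (char_inv \<chi>) (a * d * char_inv e * \<chi> * \<chi>) *
         jacobi_sum (a * \<chi>) (char_inv e) * jacobi_sum (d * char_inv e * \<chi>) e =
        (\<Sum>(v, S, T)\<in>UNIV. char_at (char_inv \<chi>) v * char_at (a * d * char_inv e * \<chi> * \<chi>) (1 - v) *
          (char_at (a * \<chi>) S * char_at (char_inv e) (1 - S) *
           (char_at (d * char_inv e * \<chi>) T * char_at e (1 - T))))"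
      unfolding jacobi_sum_def sum_product3 ..
    then show "char_at \<chi> z * char_at (char_inv (a * d * char_inv e * \<chi> * \<chi>)) (1 - z) *
        (jacobi_sum (char_inv \<chi>) (a * d * char_inv e * \<chi> * \<chi>) *
         jacobi_sum (a * \<chi>) (char_inv e) * jacobi_sum (d * char_inv e * \<chi>) e) =
        (\<Sum>p\<in>UNIV. wt p * char_at \<chi> (\<rho> p))"
      by (auto simp: sum_distrib_left wt_def \<rho>_def char_at_simps divide_inverse power2_eq_square
          mult_ac intro!: sum.cong)
  qed simp
  also have "\<dots> = (\<Sum>p\<in>UNIV. \<Sum>\<chi>\<in>UNIV. wt p * char_at \<chi> (\<rho> p))"
    by (rule sum.swap)
  also have "\<dots> = (\<Sum>p\<in>UNIV. wt p * (if \<rho> p = 1 then of_nat CARD('a) - 1 else 0))"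
    by (simp only: sum_mult_char flip: sum_distrib_left)
  also have "\<dots> = (\<Sum>p\<in>{p. \<rho> p = 1}. (of_nat CARD('a) - 1) * wt p)"
    by (rule sum.mono_neutral_cong_right) auto
  also have "\<dots> = (\<Sum>p\<in>R. (of_nat CARD('a) - 1) * case_prod kernel p)"
  proof (rule sum.reindex_bij_witness[of _ G F])
    fix p
    assume p: "p \<in> {p. \<rho> p = 1}"
    obtain v S T where vST: "p = (v, S, T)" by (cases p)
    \<comment> \<open>Since x/0 = 0 differs from 1, \<open>\<rho> p = 1\<close> already excludes a
      vanishing denominator.\<close>
    have *: "v \<noteq> 0" "1 - v \<noteq> 0" "S \<noteq> 0" "T \<noteq> 0" and eq: "z * S * T * (1 - v) ^ 2 = v * (1 - z) ^ 2"
      using p z by (auto simp: vST \<rho>_def split: if_splits)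
    define s where "s = S * (1 - v) / (1 - z)"
    define t where "t = T * (1 - v) / (1 - z)"
    have "s * t * z = (z * S * T * (1 - v) ^ 2) / (1 - z) ^ 2"
      by (simp add: s_def t_def power2_eq_square)
    then have stz: "s * t * z = v"
      using z by (simp add: eq)
    have S: "s * ((1 - z) / (1 - v)) = S" and T: "t * ((1 - z) / (1 - v)) = T"
      using * z by (simp_all add: s_def t_def)
    have Fp: "F p = (s, t)"
      by (simp add: F_def vST s_def t_def)
    show "G (F p) = p"
      by (simp only: Fp G_def prod.case) (simp only: stz S T vST)
    show "F p \<in> R"
    proof -
      have "s \<noteq> 0" "t \<noteq> 0"
        using * z by (simp_all add: s_def t_def)
      then show ?thesis
        using *(2) stz by (auto simp: Fp R_def)
    qed
    \<comment> \<open>Numerator and denominator of the quotient inside \<open>e\<close> both contain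
      1-v; cancelling it separates \<open>S\<close> from \<open>T\<close>.\<close>
    define N where "N = 1 - v - t * (1 - z)"
    define M where "M = 1 - v - s * (1 - z)"
    have "1 - T = N / (1 - v)" "1 - S = M / (1 - v)"
      using * by (simp_all add: N_def M_def field_simps flip: S T)
    then have ratio: "(1 - T) / (1 - S) = N / M"
      using * by simp
    have "kernel s t = char_at e (N / M) * char_at (d * char_inv e) t * char_at a s"
      by (simp only: kernel_def stz N_def M_def)
    also have "\<dots> = wt p"
      using * z unfolding vST wt_def prod.case ratio s_def t_def
      unfolding char_at_simps
      by (simp add: field_simps)
    finally show "(of_nat CARD('a) - 1) * case_prod kernel (F p) = (of_nat CARD('a) - 1) * wt p"
      by (simp add: Fp)
  next
    fix p
    assume p: "p \<in> R"
    obtain s t where st: "p = (s, t)" by (cases p)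
    have *: "s \<noteq> 0" "t \<noteq> 0" "1 - s * t * z \<noteq> 0"
      using p by (auto simp: st R_def)
    then show "F (G p) = p"
      using z by (simp add: st F_def G_def)
    define c where "c = (1 - z) / (1 - s * t * z)"
    have "c * (1 - s * t * z) = 1 - z" "c \<noteq> 0"
      using * z by (simp_all add: c_def)
    then have "\<rho> (G p) = z * (s * c) * (t * c) * (1 - s * t * z) ^ 2 / (s * t * z * (c * (1 - s * t * z)) ^ 2)"
      by (simp add: st G_def \<rho>_def c_def)
    also have "\<dots> = 1"
      using * z \<open>c \<noteq> 0\<close> by (simp add: power2_eq_square)
    finally show "G p \<in> {p. \<rho> p = 1}"
      by simp
  qed
  also have "\<dots> = (of_nat CARD('a) - 1) * (\<Sum>(s, t)\<in>UNIV. kernel s t)"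
    by (simp add: sum_kernel_hyperbola R_def sum_distrib_left)
  finally show ?thesis ..
qed

end

section \<open>The coefficients of both sides in Gauss sums\<close>

lemma char_inv_quad_char [simp]: "char_inv quad_char = quad_char"
  by (metis char_inv_mult_cancel(3) mult.right_neutral quad_char_mult_self)

context additive_character
begin

text \<open>
  Using three Gauss sums and no quotient, this form also covers \<open>A * B = 1\<close>; hence no character
  \<open>\<chi>\<close> is exceptional when the coefficients are compared.
\<close>

lemma jacobi_sum_eq_gauss3:
  assumes "A \<noteq> 1 \<or> B \<noteq> 1"
  shows "of_nat CARD('a) * jacobi_sum A B =
    char_at (A * B) (-1) * gauss A * gauss B * gauss (char_inv (A * B))"
proof (cases "A * B = 1")
  case True
  then have B: "B = char_inv A"
    by (metis char_inv_mult_cancel(3) mult.right_neutral)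
  then have A: "A \<noteq> 1"
    using assms by auto
  have "jacobi_sum A B = - char_at A (-1)"
    using jacobi_sum_reflect[of A B] jacobi_sum_one[OF A] True by simp
  then show ?thesis
    using gauss_mult_inv[OF A] True by (simp add: B gauss_one char_at_one)
next
  case False
  have "char_at (A * B) (-1) * (gauss (A * B) * gauss (char_inv (A * B))) = of_nat CARD('a)"
    using char_at_minus_1_square[of "A * B"] by (simp add: gauss_mult_inv[OF False])
  then have "of_nat CARD('a) * jacobi_sum A B =
      char_at (A * B) (-1) * (jacobi_sum A B * gauss (A * B)) * gauss (char_inv (A * B))"
    by (simp add: mult_ac)
  also have "jacobi_sum A B * gauss (A * B) = gauss A * gauss B"
    by (simp add: jacobi_sum_eq_gauss[OF False])
  finally show ?thesis
    by (simp add: mult_ac)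
qed

text \<open>Three Jacobi sums bring q^3, but g(e) g(1/e) = q by evenness, so q^2 remains; of the
  three signs \<chi>(-1) one remains.\<close>

lemma jacobi_product_2F1:
  assumes even: "char_at a (-1) = 1" "char_at d (-1) = 1" "char_at e (-1) = 1"
    and ne: "e \<noteq> 1" "a * d * char_inv e \<noteq> 1"
  shows "of_nat CARD('a) ^ 2 *
      (jacobi_sum (char_inv \<chi>) (a * d * char_inv e * \<chi> * \<chi>) *
       jacobi_sum (a * \<chi>) (char_inv e) * jacobi_sum (d * char_inv e * \<chi>) e) =
    char_at \<chi> (-1) *
      (gauss (char_inv \<chi>) * gauss (a * d * char_inv e * \<chi> * \<chi>) * gauss (char_inv (a * d * char_inv e * \<chi>)) *
       gauss (a * \<chi>) * gauss (char_inv (a * char_inv e * \<chi>)) *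
       gauss (d * char_inv e * \<chi>) * gauss (char_inv (d * \<chi>)))"
proof -
  define q where "q = (of_nat CARD('a) :: complex)"
  have "q \<noteq> 0"
    using card_field_gt_1[where 'a = 'a] by (simp add: q_def)
  have prods: "char_inv \<chi> * (a * d * char_inv e * \<chi> * \<chi>) = a * d * char_inv e * \<chi>"
    "a * \<chi> * char_inv e = a * char_inv e * \<chi>" "d * char_inv e * \<chi> * e = d * \<chi>"
    by (rule mult_char_eqI; simp add: char_at_simps field_simps)+
  have "char_inv \<chi> \<noteq> 1 \<or> a * d * char_inv e * \<chi> * \<chi> \<noteq> 1"
    using ne by (cases "\<chi> = 1") auto
  from jacobi_sum_eq_gauss3[OF this]
  have 1: "q * jacobi_sum (char_inv \<chi>) (a * d * char_inv e * \<chi> * \<chi>) =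
      char_at \<chi> (-1) * gauss (char_inv \<chi>) * gauss (a * d * char_inv e * \<chi> * \<chi>) *
        gauss (char_inv (a * d * char_inv e * \<chi>))"
    unfolding prods by (simp add: q_def even char_at_times char_at_char_inv)
  have 2: "q * jacobi_sum (a * \<chi>) (char_inv e) =
      char_at \<chi> (-1) * gauss (a * \<chi>) * gauss (char_inv e) * gauss (char_inv (a * char_inv e * \<chi>))"
    using jacobi_sum_eq_gauss3[of "a * \<chi>" "char_inv e"] ne unfolding prods
    by (simp add: q_def even char_at_times char_at_char_inv)
  have 3: "q * jacobi_sum (d * char_inv e * \<chi>) e =
      char_at \<chi> (-1) * gauss (d * char_inv e * \<chi>) * gauss e * gauss (char_inv (d * \<chi>))"
    using jacobi_sum_eq_gauss3[of "d * char_inv e * \<chi>" e] ne unfolding prods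
    by (simp add: q_def even char_at_times char_at_char_inv)
  have 4: "gauss e * gauss (char_inv e) = q"
    using gauss_mult_inv[OF ne(1)] by (simp add: q_def even)
  let ?J = "jacobi_sum (char_inv \<chi>) (a * d * char_inv e * \<chi> * \<chi>) *
       jacobi_sum (a * \<chi>) (char_inv e) * jacobi_sum (d * char_inv e * \<chi>) e"
  let ?\<Gamma> = "gauss (char_inv \<chi>) * gauss (a * d * char_inv e * \<chi> * \<chi>) * gauss (char_inv (a * d * char_inv e * \<chi>)) *
       gauss (a * \<chi>) * gauss (char_inv (a * char_inv e * \<chi>)) *
       gauss (d * char_inv e * \<chi>) * gauss (char_inv (d * \<chi>))"
  have "q * (q ^ 2 * ?J) = (q * jacobi_sum (char_inv \<chi>) (a * d * char_inv e * \<chi> * \<chi>)) *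
       (q * jacobi_sum (a * \<chi>) (char_inv e)) * (q * jacobi_sum (d * char_inv e * \<chi>) e)"
    by (simp add: power2_eq_square)
  also have "\<dots> = (char_at \<chi> (-1) * char_at \<chi> (-1)) * char_at \<chi> (-1) * (gauss e * gauss (char_inv e)) * ?\<Gamma>"
    unfolding 1 2 3 by (simp only: mult_ac)
  also have "\<dots> = q * (char_at \<chi> (-1) * ?\<Gamma>)"
    unfolding char_at_minus_1_square 4 by simp
  finally show ?thesis
    using \<open>q \<noteq> 0\<close> by (simp add: q_def)
qed

text \<open>This explains the prefactor. The arguments of the third and fourth Jacobi sums multiply
  to \<open>W\<close> and \<open>V\<close>, independently of \<chi>, so g(W) g(V) cancels their
  third Gauss sums up to q^2 and signs that square to 1. The first two give g(a) g(1/a) = q, and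
  duplication at \<open>X * \<chi>\<close> removes g(\<phi>).\<close>

lemma jacobi_product_4F3:
  fixes A D E \<chi> :: "'a mult_char"
  defines "a \<equiv> A ^ 2" and "d \<equiv> D ^ 2" and "e \<equiv> E ^ 2" and "X \<equiv> A * D * char_inv E"
  assumes 2: "(2 :: 'a) \<noteq> 0" and a: "a \<noteq> 1" and ade: "a * char_inv d * char_inv e \<noteq> 1"
  shows "of_nat CARD('a) *
      (char_at (X * \<chi>) 4 * (gauss (A * char_inv E * char_inv D) * gauss (char_inv A * E * D * quad_char) / gauss quad_char) *
       (jacobi_sum (a * \<chi>) (char_inv \<chi>) *
        jacobi_sum (d * char_inv e * \<chi>) (char_inv (a * d * char_inv e * \<chi>)) *
        jacobi_sum (X * \<chi>) (char_inv (d * \<chi>)) *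
        jacobi_sum (X * quad_char * \<chi>) (char_inv (a * char_inv e * \<chi>)))) =
      gauss (char_inv \<chi>) * gauss (a * d * char_inv e * \<chi> * \<chi>) * gauss (char_inv (a * d * char_inv e * \<chi>)) *
       gauss (a * \<chi>) * gauss (char_inv (a * char_inv e * \<chi>)) *
       gauss (d * char_inv e * \<chi>) * gauss (char_inv (d * \<chi>))"
proof -
  define q where "q = (of_nat CARD('a) :: complex)"
  have "q \<noteq> 0"
    using card_field_gt_1[where 'a = 'a] by (simp add: q_def)
  define W where "W = A * char_inv E * char_inv D"
  define V where "V = char_inv A * E * D * quad_char"
  have a_even: "char_at a (-1) = 1"
    using char_at_minus_1_square[of A] by (simp add: a_def power2_eq_square char_at_times)
  have "W * W = a * char_inv d * char_inv e"
    unfolding W_def a_def d_def e_def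
    by (rule mult_char_eqI) (simp add: char_at_simps char_at_power field_simps power2_eq_square)
  then have WW: "W * W \<noteq> 1"
    using ade by simp
  then have W: "W \<noteq> 1" by auto
  have "V = char_inv W * quad_char"
    unfolding V_def W_def by (rule mult_char_eqI) (simp add: char_at_simps field_simps)
  \<comment> \<open>A trivial \<open>V\<close> would mean \<open>W = quad_char\<close>, hence W^2 =
    1.\<close>
  then have V: "V \<noteq> 1"
    using WW by (metis char_inv_eq_1_iff char_inv_mult char_inv_quad_char mult_char_mult_inv_eq_1_iff quad_char_mult_self)
  have prods: "a * \<chi> * char_inv \<chi> = a"
    "d * char_inv e * \<chi> * char_inv (a * d * char_inv e * \<chi>) = char_inv a"
    "X * \<chi> * char_inv (d * \<chi>) = W"
    "X * quad_char * \<chi> * char_inv (a * char_inv e * \<chi>) = V"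
    "X * \<chi> * (X * \<chi>) = a * d * char_inv e * \<chi> * \<chi>"
    "X * \<chi> * quad_char = X * quad_char * \<chi>"
    unfolding a_def d_def e_def X_def W_def V_def
    by (rule mult_char_eqI; simp add: char_at_simps char_at_power field_simps power2_eq_square)+
  have nontriv: "P \<noteq> 1 \<or> Q \<noteq> 1" if "P * Q = C" "C \<noteq> 1" for P Q C :: "'a mult_char"
    using that by auto
  have 1: "q * jacobi_sum (a * \<chi>) (char_inv \<chi>) = gauss (a * \<chi>) * gauss (char_inv \<chi>) * gauss (char_inv a)"
    using jacobi_sum_eq_gauss3[OF nontriv[OF prods(1) a]] unfolding prods by (simp add: q_def a_even)
  have 2: "q * jacobi_sum (d * char_inv e * \<chi>) (char_inv (a * d * char_inv e * \<chi>)) =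
      gauss (d * char_inv e * \<chi>) * gauss (char_inv (a * d * char_inv e * \<chi>)) * gauss a"
    using jacobi_sum_eq_gauss3[OF nontriv[OF prods(2)]] a unfolding prods
    by (simp add: q_def a_even char_at_char_inv)
  have 3: "q * jacobi_sum (X * \<chi>) (char_inv (d * \<chi>)) =
      char_at W (-1) * gauss (X * \<chi>) * gauss (char_inv (d * \<chi>)) * gauss (char_inv W)"
    using jacobi_sum_eq_gauss3[OF nontriv[OF prods(3) W]] unfolding prods by (simp add: q_def)
  have 4: "q * jacobi_sum (X * quad_char * \<chi>) (char_inv (a * char_inv e * \<chi>)) =
      char_at V (-1) * gauss (X * quad_char * \<chi>) * gauss (char_inv (a * char_inv e * \<chi>)) * gauss (char_inv V)"
    using jacobi_sum_eq_gauss3[OF nontriv[OF prods(4) V]] unfolding prods by (simp add: q_def)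
  have 5: "gauss W * gauss (char_inv W) = char_at W (-1) * q" "gauss V * gauss (char_inv V) = char_at V (-1) * q"
    "gauss a * gauss (char_inv a) = q"
    using gauss_mult_inv[OF W] gauss_mult_inv[OF V] gauss_mult_inv[OF a] by (simp_all add: q_def a_even)
  have 6: "char_at (X * \<chi>) 4 * (gauss (X * \<chi>) * gauss (X * quad_char * \<chi>)) =
      gauss (a * d * char_inv e * \<chi> * \<chi>) * gauss quad_char"
    using gauss_duplication[OF assms(5), of "X * \<chi>"] unfolding prods .
  let ?J1 = "jacobi_sum (a * \<chi>) (char_inv \<chi>)"
  let ?J2 = "jacobi_sum (d * char_inv e * \<chi>) (char_inv (a * d * char_inv e * \<chi>))"
  let ?J3 = "jacobi_sum (X * \<chi>) (char_inv (d * \<chi>))"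
  let ?J4 = "jacobi_sum (X * quad_char * \<chi>) (char_inv (a * char_inv e * \<chi>))"
  let ?R = "gauss (char_inv \<chi>) * gauss (char_inv (a * d * char_inv e * \<chi>)) *
       gauss (a * \<chi>) * gauss (char_inv (a * char_inv e * \<chi>)) *
       gauss (d * char_inv e * \<chi>) * gauss (char_inv (d * \<chi>))"
  have "q ^ 3 * (q * (char_at (X * \<chi>) 4 * (gauss W * gauss V / gauss quad_char) * (?J1 * ?J2 * ?J3 * ?J4))) =
      char_at (X * \<chi>) 4 * (gauss W * gauss V) * ((q * ?J1) * (q * ?J2) * (q * ?J3) * (q * ?J4)) / gauss quad_char"
    by (simp add: power3_eq_cube)
  also have "\<dots> = (gauss W * gauss (char_inv W)) * (gauss V * gauss (char_inv V)) * (gauss a * gauss (char_inv a)) *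
      (char_at (X * \<chi>) 4 * (gauss (X * \<chi>) * gauss (X * quad_char * \<chi>))) *
      char_at W (-1) * char_at V (-1) * ?R / gauss quad_char"
    unfolding 1 2 3 4 by (simp only: mult_ac)
  also have "\<dots> = (char_at W (-1) * char_at W (-1)) * (char_at V (-1) * char_at V (-1)) * (q * q * q) *
      (gauss (a * d * char_inv e * \<chi> * \<chi>) * ?R)"
    unfolding 5 6 by simp
  also have "\<dots> = q ^ 3 * (gauss (a * d * char_inv e * \<chi> * \<chi>) * ?R)"
    unfolding char_at_minus_1_square by (simp add: power3_eq_cube)
  finally show ?thesis
    unfolding mult_left_cancel[OF power_not_zero[OF \<open>q \<noteq> 0\<close>]]
    unfolding q_def W_def V_def
    by (simp only: mult_ac)
qed

end

section \<open>Comparison of the coefficients\<close>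

theorem theorem1p4:
  fixes A D E :: "'a::{field,finite} mult_char"
    and z :: 'a
    and p r :: nat
    and \<zeta> :: complex
  assumes "prime p" "odd p" "CARD('a) = p ^ r"
    and "primitive_root_of_unity p \<zeta>"
    and "A^2 \<noteq> 1" "E^2 \<noteq> 1"
    and "A^2 * char_inv (D^2) * char_inv (E^2) \<noteq> 1"
    and "A^2 * D^2 * char_inv (E^2) \<noteq> 1"
    and "A^2 \<noteq> D^2" "D^2 \<noteq> E^2"
    and "z \<noteq> 1"
  shows
    "greene_F (A^2) [E^2] [D^2] z *
       greene_F (D^2 * char_inv (E^2)) [char_inv (E^2)] [A^2 * char_inv (E^2)] z =
     char_at (E^2) z / of_nat CARD('a) * delta (1 - z^2) +
     char_at (A * D * char_inv E) 4 *
       char_at (char_inv (A^2) * char_inv (D^2) * E^2) (1 - z) *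
       gauss_sum \<zeta> p r (A * char_inv E * char_inv D) *
       gauss_sum \<zeta> p r (char_inv A * E * D * quad_char) /
       gauss_sum \<zeta> p r (quad_char :: 'a mult_char) *
       greene_F (A^2)
         [D^2 * char_inv (E^2), A * D * char_inv E, A * D * char_inv E * quad_char]
         [A^2 * D^2 * char_inv (E^2), D^2, A^2 * char_inv (E^2)]
         (- 4 * z / (1 - z)^2)"
proof -
  define q where "q = (of_nat CARD('a) :: complex)"
  define a d e where "a = A ^ 2" and "d = D ^ 2" and "e = E ^ 2"
  define X where "X = A * D * char_inv E"
  interpret additive_character "add_char \<zeta> p r :: 'a \<Rightarrow> complex"
    using assms(1,3,4) by (rule additive_character_add_char)
  have gauss: "gauss_sum \<zeta> p r \<chi> = gauss \<chi>" for \<chi> :: "'a mult_char"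
    by (simp add: gauss_sum_def gauss_def)
  have q: "q \<noteq> 0" "q - 1 \<noteq> 0"
    using card_field_gt_1[where 'a = 'a] by (simp_all add: q_def)
  have two: "(2 :: 'a) \<noteq> 0"
  proof
    assume "(2 :: 'a) = 0"
    then have "of_nat 2 = (0 :: 'a)" by simp
    then have "p dvd 2"
      using prime_char_from_card[OF assms(1,3)] of_nat_eq_0_iff_char_dvd by metis
    then show False
      using assms(1,2) prime_ge_2_nat[of p] dvd_imp_le[of p 2] by (cases "p = 2") auto
  qed
  have even: "char_at a (-1) = 1" "char_at d (-1) = 1" "char_at e (-1) = 1"
    by (simp_all add: a_def d_def e_def power2_eq_square char_at_times char_at_minus_1_square)
  have ne: "a \<noteq> 1" "e \<noteq> 1" "a * char_inv d * char_inv e \<noteq> 1" "a * d * char_inv e \<noteq> 1" "a \<noteq> d" "d \<noteq> e"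
    using assms by (simp_all add: a_def d_def e_def)
  show ?thesis
  \<comment> \<open>At z = 0 every term of the identity contains a character evaluated at 0; the
    integral representation requires a nonzero argument.\<close>
  proof (cases "z = 0")
    case True
    then show ?thesis
      by (simp add: greene_F_def)
  next
    case False
    then have z: "z \<noteq> 0" "z \<noteq> 1" "1 - z \<noteq> 0"
      using assms(11) by auto
    have a_neq_de: "a \<noteq> d * e"
    proof -
      have "d * e * char_inv d * char_inv e = 1"
        by (rule mult_char_eqI) (simp add: char_at_simps char_at_one field_simps)
      then show ?thesis
        using ne(3) by auto
    qed
    interpret series_product a d e z
      using even ne a_neq_de z by unfold_locales auto
    define K where "K = (\<Sum>(s, t)\<in>UNIV. kernel s t)"
    have F1: "greene_F a [e] [d] z = (\<Sum>y\<in>UNIV. char_at e y * char_at (d * char_inv e) (1 - y) *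
        char_at (char_inv a) (1 - z * y)) / q"
      using z by (simp add: greene_F_2F1_eq_sum q_def even char_at_times)
    have "char_inv (d * char_inv e) = char_inv d * e" "a * char_inv e * char_inv (char_inv e) = a"
      by (simp_all add: char_inv_mult mult.assoc)
    then have F2: "greene_F (d * char_inv e) [char_inv e] [a * char_inv e] z =
        (\<Sum>w\<in>UNIV. char_at (char_inv e) w * char_at a (1 - w) *
          char_at (char_inv (d * char_inv e)) (1 - z * w)) / q"
      using z by (simp add: greene_F_2F1_eq_sum q_def even char_at_times char_at_char_inv)
    have "greene_F a [e] [d] z * greene_F (d * char_inv e) [char_inv e] [a * char_inv e] z =
        K / q ^ 2 + (if z = -1 then q else 0) / q ^ 2"
      unfolding F1 F2 K_def q_def add_divide_distrib[symmetric] sum_integrand[symmetric] sum_integrand_eq_prod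
      by (simp add: power2_eq_square)
    also have "(if z = -1 then q else 0) / q ^ 2 = char_at e z / q * delta (1 - z ^ 2)"
    proof -
      have "1 - z ^ 2 = 0 \<longleftrightarrow> z = -1"
        using z power2_eq_1_iff[of z] by auto
      then show ?thesis
        using q even by (auto simp: delta_def power2_eq_square)
    qed
    finally have lhs: "greene_F a [e] [d] z * greene_F (d * char_inv e) [char_inv e] [a * char_inv e] z =
        K / q ^ 2 + char_at e z / q * delta (1 - z ^ 2)" .
    define P where "P = gauss (A * char_inv E * char_inv D) * gauss (char_inv A * E * D * quad_char) / gauss quad_char"
    define J4 where "J4 \<chi> = jacobi_sum (a * \<chi>) (char_inv \<chi>) *
        jacobi_sum (d * char_inv e * \<chi>) (char_inv (a * d * char_inv e * \<chi>)) *
        jacobi_sum (X * \<chi>) (char_inv (d * \<chi>)) *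
        jacobi_sum (X * quad_char * \<chi>) (char_inv (a * char_inv e * \<chi>))" for \<chi>
    define J2 where "J2 \<chi> = jacobi_sum (char_inv \<chi>) (a * d * char_inv e * \<chi> * \<chi>) *
        jacobi_sum (a * \<chi>) (char_inv e) * jacobi_sum (d * char_inv e * \<chi>) e" for \<chi>
    \<comment> \<open>The factors \<chi>(4) and \<chi>(-1) are exactly what -4 contributes to
      \<chi>(-4z/(1-z)^2).\<close>
    have J: "char_at X 4 * char_at \<chi> 4 * P * J4 \<chi> = q * char_at \<chi> (-1) * J2 \<chi>" for \<chi>
    proof -
      define \<Gamma> where "\<Gamma> = gauss (char_inv \<chi>) * gauss (a * d * char_inv e * \<chi> * \<chi>) *
          gauss (char_inv (a * d * char_inv e * \<chi>)) * gauss (a * \<chi>) * gauss (char_inv (a * char_inv e * \<chi>)) *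
          gauss (d * char_inv e * \<chi>) * gauss (char_inv (d * \<chi>))"
      have "q * (char_at (X * \<chi>) 4 * P * J4 \<chi>) = \<Gamma>"
        unfolding q_def P_def J4_def \<Gamma>_def
        by (rule jacobi_product_4F3[OF two, where A = A and D = D and E = E,
            folded a_def d_def e_def X_def, OF ne(1) ne(3)])
      also have "\<dots> = char_at \<chi> (-1) * (char_at \<chi> (-1) * \<Gamma>)"
        by (simp add: char_at_minus_1_square flip: mult.assoc)
      also have "char_at \<chi> (-1) * \<Gamma> = q ^ 2 * J2 \<chi>"
        unfolding q_def J2_def \<Gamma>_def by (rule jacobi_product_2F1[OF even ne(2) ne(4), symmetric])
      finally show ?thesis
        using q by (simp add: power2_eq_square char_at_times mult_ac)
    qed
    have summand: "char_binom (a * \<chi>) \<chi> * (char_binom (d * char_inv e * \<chi>) (a * d * char_inv e * \<chi>) *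
          (char_binom (X * \<chi>) (d * \<chi>) * char_binom (X * quad_char * \<chi>) (a * char_inv e * \<chi>))) *
        char_at \<chi> (- 4 * z / (1 - z) ^ 2) * (char_at X 4 * char_at (char_inv a * char_inv d * e) (1 - z) * P) =
        char_at \<chi> z * char_at (char_inv (a * d * char_inv e * \<chi> * \<chi>)) (1 - z) * J2 \<chi> / q ^ 3" for \<chi>
    proof -
      have sq: "char_at \<chi> (-1) * (char_at \<chi> (-1) * w) = w" for w
        using char_at_minus_1_square[of \<chi>] by (simp flip: mult.assoc)
      \<comment> \<open>Each binomial carries the sign \<chi>(-1), the other characters being even;
        the four signs cancel.\<close>
      have "char_binom (a * \<chi>) \<chi> * (char_binom (d * char_inv e * \<chi>) (a * d * char_inv e * \<chi>) *
          (char_binom (X * \<chi>) (d * \<chi>) * char_binom (X * quad_char * \<chi>) (a * char_inv e * \<chi>))) = J4 \<chi> / q ^ 4"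
        unfolding char_binom_eq_jacobi_sum J4_def q_def[symmetric]
        by (simp add: char_at_times char_at_char_inv even sq mult_ac eval_nat_numeral)
      moreover have "- 4 * z / (1 - z) ^ 2 = (-1) * 4 * z * inverse (1 - z) * inverse (1 - z)"
        by (simp add: divide_inverse power2_eq_square)
      then have "char_at \<chi> (- 4 * z / (1 - z) ^ 2) =
          char_at \<chi> (-1) * char_at \<chi> 4 * char_at \<chi> z * inverse (char_at \<chi> (1 - z)) * inverse (char_at \<chi> (1 - z))"
        by (simp only: char_at_mult_arg char_at_inverse_arg)
      then have "char_at \<chi> (- 4 * z / (1 - z) ^ 2) * (char_at X 4 * char_at (char_inv a * char_inv d * e) (1 - z) * P) =
          char_at \<chi> (-1) * char_at \<chi> z * char_at (char_inv (a * d * char_inv e * \<chi> * \<chi>)) (1 - z) *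
            (char_at X 4 * char_at \<chi> 4 * P)"
        by (simp add: char_at_times char_at_char_inv mult_ac)
      ultimately have "char_binom (a * \<chi>) \<chi> * (char_binom (d * char_inv e * \<chi>) (a * d * char_inv e * \<chi>) *
          (char_binom (X * \<chi>) (d * \<chi>) * char_binom (X * quad_char * \<chi>) (a * char_inv e * \<chi>))) *
        char_at \<chi> (- 4 * z / (1 - z) ^ 2) * (char_at X 4 * char_at (char_inv a * char_inv d * e) (1 - z) * P) =
        J4 \<chi> / q ^ 4 * (char_at \<chi> (-1) * char_at \<chi> z *
          char_at (char_inv (a * d * char_inv e * \<chi> * \<chi>)) (1 - z) * (char_at X 4 * char_at \<chi> 4 * P))"
        by (simp only: mult.assoc)
      also have "\<dots> = char_at \<chi> (-1) * char_at \<chi> z *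
          char_at (char_inv (a * d * char_inv e * \<chi> * \<chi>)) (1 - z) * (char_at X 4 * char_at \<chi> 4 * P * J4 \<chi>) / q ^ 4"
        by simp
      also have "\<dots> = (char_at \<chi> (-1) * char_at \<chi> (-1)) * char_at \<chi> z *
          char_at (char_inv (a * d * char_inv e * \<chi> * \<chi>)) (1 - z) * J2 \<chi> * (q / q ^ 4)"
        unfolding J by simp
      also have "q / q ^ 4 = 1 / q ^ 3"
        using q by (simp add: eval_nat_numeral)
      finally show ?thesis
        by (simp add: char_at_minus_1_square)
    qed
    have "char_at X 4 * char_at (char_inv a * char_inv d * e) (1 - z) * P *
        greene_F a [d * char_inv e, X, X * quad_char] [a * d * char_inv e, d, a * char_inv e] (- 4 * z / (1 - z) ^ 2) =
        q / (q - 1) * (\<Sum>\<chi>\<in>UNIV. char_at \<chi> z *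
          char_at (char_inv (a * d * char_inv e * \<chi> * \<chi>)) (1 - z) * J2 \<chi> / q ^ 3)"
      unfolding summand[symmetric] sum_distrib_right[symmetric]
      by (simp add: greene_F_def q_def mult_ac)
    also have "\<dots> = q / (q - 1) * ((q - 1) * K / q ^ 3)"
      unfolding K_def q_def sum_kernel_mellin J2_def sum_divide_distrib ..
    also have "\<dots> = K / q ^ 2"
      using q by (simp add: power2_eq_square power3_eq_cube)
    finally have rhs: "char_at X 4 * char_at (char_inv a * char_inv d * e) (1 - z) * P *
        greene_F a [d * char_inv e, X, X * quad_char] [a * d * char_inv e, d, a * char_inv e] (- 4 * z / (1 - z) ^ 2) =
        K / q ^ 2" .
    have "greene_F a [e] [d] z * greene_F (d * char_inv e) [char_inv e] [a * char_inv e] z =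
        char_at e z / q * delta (1 - z ^ 2) +
        char_at X 4 * char_at (char_inv a * char_inv d * e) (1 - z) * P *
          greene_F a [d * char_inv e, X, X * quad_char] [a * d * char_inv e, d, a * char_inv e] (- 4 * z / (1 - z) ^ 2)"
      by (simp only: lhs rhs add.commute)
    then show ?thesis
      by (simp only: gauss P_def q_def X_def a_def d_def e_def mult.assoc times_divide_eq_left times_divide_eq_right)
  qed
qed

end
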